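(* Let $R$ be a $\mathbb{Z}^n$-graded Noetherian ring. If $I\subset R$ is a $\mathbb{Z}^n$-graded ideal, then $C(I)$ is a $\mathbb{Z}^n$-graded ideal.
   Context: All rings are commutative with unit. For a Noetherian ring $R$ and an ideal $I=(f_1,\ldots,f_m)\subseteq R$, let $\mathcal{R}(I)=R[f_1t,\ldots,f_mt]\subseteq R[t]$ be the Rees algebra, $T=R[y_1,\ldots,y_m]$ a polynomial ring, $\varphi:T\to\mathcal{R}(I)$ the $R$-algebra homomorphism with $\varphi(y_j)=f_jt$, and $J=\ker\varphi$. Let $L\subseteq J$ be the ideal of $T$ generated by all linear relations $\sum_{i=1}^m a_iy_i$ with $a_i\in R$ and $\sum_i a_if_i=0$. Then $T/L\cong S(I)$ is the symmetric algebra of $I$, and the kernel of the canonical epimorphism $\alpha:S(I)\to\mathcal{R}(I)$ is $J/L$. The conductor of $I$ is the ideal $C(I)=L:_RJ=\{r\in R: rJ\subseteq L\}=\mathrm{Ann}_R(\ker\alpha)$ of $R$; it does not depend on the chosen generators. *)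

theory Defs
  imports "HOL-Algebra.Algebra"
begin

definition homogeneous_decomposition ::
    "('a, 'm) ring_scheme \<Rightarrow> ('g, 'n) monoid_scheme \<Rightarrow> ('g \<Rightarrow> 'a set) \<Rightarrow> 'a \<Rightarrow> ('g \<Rightarrow> 'a) \<Rightarrow> bool"
  where "homogeneous_decomposition R G A r c \<longleftrightarrow>
    c \<in> (\<Pi>\<^sub>E g\<in>carrier G. A g) \<and> finite {g \<in> carrier G. c g \<noteq> \<zero>\<^bsub>R\<^esub>} \<and>
    r = (\<Oplus>\<^bsub>R\<^esub>g\<in>{g \<in> carrier G. c g \<noteq> \<zero>\<^bsub>R\<^esub>}. c g)"

text \<open>The axiom \<open>direct_sum\<close> says that \<open>R\<close> is the internal direct sum of the subgroups \<open>A g\<close>.\<close>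

locale graded_ring = R: cring R + G: comm_group G
  for R (structure) and G (structure) and A +
  assumes component_subgroup: "g \<in> carrier G \<Longrightarrow> additive_subgroup (A g) R"
    and component_mult: "\<lbrakk>g \<in> carrier G; h \<in> carrier G; a \<in> A g; b \<in> A h\<rbrakk>
          \<Longrightarrow> a \<otimes>\<^bsub>R\<^esub> b \<in> A (g \<otimes>\<^bsub>G\<^esub> h)"
    and direct_sum: "r \<in> carrier R \<Longrightarrow> \<exists>!c. homogeneous_decomposition R G A r c"

text \<open>An ideal is graded if it is the sum of its intersections with the \<open>A g\<close>; the sum is
  automatically direct.\<close>

definition graded_ideal ::
    "('a, 'm) ring_scheme \<Rightarrow> ('g, 'n) monoid_scheme \<Rightarrow> ('g \<Rightarrow> 'a set) \<Rightarrow> 'a set \<Rightarrow> bool"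
  where "graded_ideal R G A I \<longleftrightarrow>
    ideal I R \<and> (\<forall>r\<in>I. \<exists>c. homogeneous_decomposition R G (\<lambda>g. I \<inter> A g) r c)"

definition int_power_group :: "nat \<Rightarrow> (nat \<Rightarrow> int) monoid"
  where "int_power_group n = product_group {..<n} (\<lambda>_. integer_group)"

text \<open>The polynomial ring over \<open>R\<close> in the variables \<open>y\<^sub>i\<close>, \<open>i < m\<close>, built on the indexed polynomials
  of HOL-Algebra, which come without a multiplication. A polynomial maps each monomial, a multiset
  of variable indices, to its coefficient.\<close>

definition mpoly_mult ::
    "('a, 'm) ring_scheme \<Rightarrow> ('c multiset \<Rightarrow> 'a) \<Rightarrow> ('c multiset \<Rightarrow> 'a) \<Rightarrow> 'c multiset \<Rightarrow> 'a"
  where "mpoly_mult R P Q = (\<lambda>\<mu>. \<Oplus>\<^bsub>R\<^esub>\<nu>\<in>{\<nu>. \<nu> \<subseteq># \<mu>}. P \<nu> \<otimes>\<^bsub>R\<^esub> Q (\<mu> - \<nu>))"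

definition mpoly_ring :: "('a, 'm) ring_scheme \<Rightarrow> nat \<Rightarrow> (nat multiset \<Rightarrow> 'a) ring"
  where "mpoly_ring R m =
    \<lparr>carrier = ring.indexed_pset R {..<m} (carrier R),
     monoid.mult = mpoly_mult R,
     one = ring.indexed_const R \<one>\<^bsub>R\<^esub>,
     ring.zero = ring.indexed_const R \<zero>\<^bsub>R\<^esub>,
     add = ring.indexed_padd R\<rparr>"

definition rees_algebra :: "('a, 'm) ring_scheme \<Rightarrow> 'a list \<Rightarrow> ('a, nat \<Rightarrow> 'a) up_ring"
  where "rees_algebra R fs = (UP R)
    \<lparr>carrier := generate_ring (UP R)
       ((\<lambda>a. monom (UP R) a 0) ` carrier R \<union> (\<lambda>f. monom (UP R) f 1) ` set fs)\<rparr>"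

text \<open>The map \<open>\<phi>\<close> is substitution of \<open>f\<^sub>i t\<close> for \<open>y\<^sub>i\<close>.\<close>

definition rees_map :: "('a, 'm) ring_scheme \<Rightarrow> 'a list \<Rightarrow> (nat multiset \<Rightarrow> 'a) \<Rightarrow> nat \<Rightarrow> 'a"
  where "rees_map R fs p =
    (\<Oplus>\<^bsub>UP R\<^esub>\<mu>\<in>{\<mu>. p \<mu> \<noteq> \<zero>\<^bsub>R\<^esub>}. monom (UP R) (p \<mu>) 0 \<otimes>\<^bsub>UP R\<^esub>
       (\<Otimes>\<^bsub>UP R\<^esub>i\<in>set_mset \<mu>. monom (UP R) (fs ! i) 1 [^]\<^bsub>UP R\<^esub> count \<mu> i))"

text \<open>With \<open>J = ker \<phi>\<close> (\<open>rees_ideal\<close>) and \<open>L\<close> the part of \<open>J\<close> generated by linear forms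
  (\<open>linear_ideal\<close>), so that \<open>S(I) = T/L\<close>, the conductor of \<open>I = (fs)\<close> is \<open>L :\<^sub>R J\<close>. As an ideal of
  \<open>R\<close> it depends only on \<open>I\<close>, not on the generators \<open>fs\<close>.\<close>

definition rees_ideal :: "('a, 'm) ring_scheme \<Rightarrow> 'a list \<Rightarrow> (nat multiset \<Rightarrow> 'a) set"
  where "rees_ideal R fs =
    a_kernel (mpoly_ring R (length fs)) (rees_algebra R fs) (rees_map R fs)"

definition linear_relations :: "('a, 'm) ring_scheme \<Rightarrow> 'a list \<Rightarrow> (nat multiset \<Rightarrow> 'a) set"
  where "linear_relations R fs =
    {\<Oplus>\<^bsub>mpoly_ring R (length fs)\<^esub>i\<in>{..<length fs}.
        ring.indexed_const R (a i) \<otimes>\<^bsub>mpoly_ring R (length fs)\<^esub> ring.indexed_var R i | a.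
      a \<in> {..<length fs} \<rightarrow> carrier R \<and>
      (\<Oplus>\<^bsub>R\<^esub>i\<in>{..<length fs}. a i \<otimes>\<^bsub>R\<^esub> fs ! i) = \<zero>\<^bsub>R\<^esub>}"

definition linear_ideal :: "('a, 'm) ring_scheme \<Rightarrow> 'a list \<Rightarrow> (nat multiset \<Rightarrow> 'a) set"
  where "linear_ideal R fs = Idl\<^bsub>mpoly_ring R (length fs)\<^esub> (linear_relations R fs)"

definition conductor :: "('a, 'm) ring_scheme \<Rightarrow> 'a list \<Rightarrow> 'a set"
  where "conductor R fs =
    {r \<in> carrier R. \<forall>p \<in> rees_ideal R fs.
       ring.indexed_const R r \<otimes>\<^bsub>mpoly_ring R (length fs)\<^esub> p \<in> linear_ideal R fs}"

text \<open>The multiplication defined above makes \<open>mpoly_ring\<close> a commutative ring,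
  so \<open>Idl\<close> is meaningful in it.\<close>

lemma finite_submsets: "finite {\<nu>. \<nu> \<subseteq># (\<mu> :: 'c multiset)}"
proof (induction \<mu>)
  case (add x \<mu>)
  have "{\<nu>. \<nu> \<subseteq># add_mset x \<mu>} \<subseteq> {\<nu>. \<nu> \<subseteq># \<mu>} \<union> add_mset x ` {\<nu>. \<nu> \<subseteq># \<mu>}"
  proof
    fix \<nu> assume "\<nu> \<in> {\<nu>. \<nu> \<subseteq># add_mset x \<mu>}"
    then have *: "\<nu> \<subseteq># add_mset x \<mu>" by simp
    show "\<nu> \<in> {\<nu>. \<nu> \<subseteq># \<mu>} \<union> add_mset x ` {\<nu>. \<nu> \<subseteq># \<mu>}"
    proof (cases "x \<in># \<nu>")
      case True
      then obtain \<nu>' where "\<nu> = add_mset x \<nu>'" by (metis mset_add)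
      with * show ?thesis by auto
    next
      case False
      with * have "\<nu> \<subseteq># \<mu>"
        by (metis add_mset_add_single diff_single_trivial subset_eq_diff_conv)
      then show ?thesis by simp
    qed
  qed
  then show ?case using add.IH by (auto intro: finite_subset)
qed simp

context cring begin

lemma mpoly_mult_closed_coeff:
  assumes "carrier_coeff P" "carrier_coeff Q"
  shows "carrier_coeff (mpoly_mult R P Q)"
  using assms unfolding carrier_coeff_def mpoly_mult_def by (auto intro!: finsum_closed)

lemma mpoly_mult_comm:
  assumes "carrier_coeff (P :: 'c multiset \<Rightarrow> 'a)" "carrier_coeff Q"
  shows "mpoly_mult R P Q = mpoly_mult R Q P"
proof
  fix \<mu> :: "'c multiset"
  have b: "bij_betw (\<lambda>\<nu>. \<mu> - \<nu>) {\<nu>. \<nu> \<subseteq># \<mu>} {\<nu>. \<nu> \<subseteq># \<mu>}"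
    by (rule bij_betwI[where g = "\<lambda>\<nu>. \<mu> - \<nu>"]) (auto simp: multiset_eq_iff subseteq_mset_def)
  have "mpoly_mult R P Q \<mu> = (\<Oplus>\<nu>\<in>(\<lambda>\<nu>. \<mu> - \<nu>) ` {\<nu>. \<nu> \<subseteq># \<mu>}. P \<nu> \<otimes> Q (\<mu> - \<nu>))"
    using b by (simp add: mpoly_mult_def bij_betw_def)
  also have "\<dots> = (\<Oplus>\<nu>\<in>{\<nu>. \<nu> \<subseteq># \<mu>}. P (\<mu> - \<nu>) \<otimes> Q (\<mu> - (\<mu> - \<nu>)))"
    using assms b by (intro add.finprod_reindex) (auto simp: carrier_coeff_def bij_betw_def)
  also have "\<dots> = mpoly_mult R Q P \<mu>"
    unfolding mpoly_mult_def
  proof (rule add.finprod_cong')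
    fix \<nu> assume "\<nu> \<in> {\<nu>. \<nu> \<subseteq># \<mu>}"
    then have "\<mu> - (\<mu> - \<nu>) = \<nu>"
      by (auto simp: multiset_eq_iff subseteq_mset_def)
    then show "P (\<mu> - \<nu>) \<otimes> Q (\<mu> - (\<mu> - \<nu>)) = Q \<nu> \<otimes> P (\<mu> - \<nu>)"
      using assms by (simp add: carrier_coeff_def m_comm)
  qed (use assms in \<open>auto simp: carrier_coeff_def\<close>)
  finally show "mpoly_mult R P Q \<mu> = mpoly_mult R Q P \<mu>" .
qed

lemma mpoly_mult_const:
  assumes "k \<in> carrier R" "carrier_coeff Q"
  shows "mpoly_mult R (indexed_const k) Q = (\<lambda>\<mu>. k \<otimes> Q \<mu>)"
proof
  fix \<mu> :: "'c multiset"
  have "mpoly_mult R (indexed_const k) Q \<mu> =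
      (\<Oplus>\<nu>\<in>{\<nu>. \<nu> \<subseteq># \<mu>}. if {#} = \<nu> then k \<otimes> Q (\<mu> - \<nu>) else \<zero>)"
    unfolding mpoly_mult_def using assms
    by (intro add.finprod_cong') (auto simp: carrier_coeff_def indexed_const_def)
  also have "\<dots> = k \<otimes> Q (\<mu> - {#})"
    using assms finite_submsets[of \<mu>]
    by (intro add.finprod_singleton) (auto simp: carrier_coeff_def)
  finally show "mpoly_mult R (indexed_const k) Q \<mu> = k \<otimes> Q \<mu>" by simp
qed

lemma mpoly_mult_add:
  assumes "carrier_coeff P" "carrier_coeff P'" "carrier_coeff Q"
  shows "mpoly_mult R (indexed_padd P P') Q = indexed_padd (mpoly_mult R P Q) (mpoly_mult R P' Q)"
  unfolding mpoly_mult_def indexed_padd_def using assms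
  by (auto simp: fun_eq_iff carrier_coeff_def l_distr finsum_addf)

lemma mpoly_mult_var:
  assumes "carrier_coeff P" "carrier_coeff Q"
  shows "mpoly_mult R (indexed_pmult P i) Q = indexed_pmult (mpoly_mult R P Q) i"
proof
  fix \<mu>
  show "mpoly_mult R (indexed_pmult P i) Q \<mu> = indexed_pmult (mpoly_mult R P Q) i \<mu>"
  proof (cases "i \<in># \<mu>")
    case False
    then have "mpoly_mult R (indexed_pmult P i) Q \<mu> = (\<Oplus>\<nu>\<in>{\<nu>. \<nu> \<subseteq># \<mu>}. \<zero>)"
      unfolding mpoly_mult_def using assms
      by (intro add.finprod_cong') (auto simp: carrier_coeff_def indexed_pmult_def dest: mset_subset_eqD)
    then show ?thesis using False by (simp add: indexed_pmult_def)
  next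
    case True
    have e: "add_mset i ` {\<nu>. \<nu> \<subseteq># \<mu> - {#i#}} \<subseteq> {\<nu>. \<nu> \<subseteq># \<mu>}"
      using True by (auto simp: insert_subset_eq_iff)
    have "mpoly_mult R (indexed_pmult P i) Q \<mu> =
      (\<Oplus>\<nu>\<in>add_mset i ` {\<nu>. \<nu> \<subseteq># \<mu> - {#i#}}. indexed_pmult P i \<nu> \<otimes> Q (\<mu> - \<nu>))"
      unfolding mpoly_mult_def
    proof (rule add.finprod_mono_neutral_cong_left[symmetric])
      fix \<nu> assume a: "\<nu> \<in> {\<nu>. \<nu> \<subseteq># \<mu>} - add_mset i ` {\<nu>. \<nu> \<subseteq># \<mu> - {#i#}}"
      have "i \<notin># \<nu>"
      proof
        assume "i \<in># \<nu>"
        then obtain \<nu>' where "\<nu> = add_mset i \<nu>'" by (metis mset_add)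
        with a show False using True by (auto simp: insert_subset_eq_iff)
      qed
      then show "indexed_pmult P i \<nu> \<otimes> Q (\<mu> - \<nu>) = \<zero>"
        using assms by (simp add: indexed_pmult_def carrier_coeff_def)
    qed (use e finite_submsets[of \<mu>] assms in \<open>auto simp: carrier_coeff_def indexed_pmult_def\<close>)
    also have "\<dots> = (\<Oplus>\<nu>\<in>{\<nu>. \<nu> \<subseteq># \<mu> - {#i#}}. indexed_pmult P i (add_mset i \<nu>) \<otimes> Q (\<mu> - add_mset i \<nu>))"
      using assms by (intro add.finprod_reindex) (auto simp: carrier_coeff_def indexed_pmult_def inj_on_def)
    also have "\<dots> = indexed_pmult (mpoly_mult R P Q) i \<mu>"
      using True assms by (simp add: indexed_pmult_def mpoly_mult_def)
    finally show ?thesis .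
  qed
qed

lemma mpoly_carrier_coeff: "P \<in> indexed_pset I (carrier R) \<Longrightarrow> carrier_coeff P"
  using indexed_pset_in_carrier by blast

lemma mpoly_mult_closed:
  fixes I :: "'c set"
  assumes "P \<in> indexed_pset I (carrier R)" "Q \<in> indexed_pset I (carrier R)"
  shows "mpoly_mult R P Q \<in> indexed_pset I (carrier R)"
  using assms(1)
proof induction
  case (indexed_const k)
  from assms(2) have "(\<lambda>\<mu>. k \<otimes> Q \<mu>) \<in> indexed_pset I (carrier R)"
  proof induction
    case (indexed_const l)
    have "(\<lambda>\<mu> :: 'c multiset. k \<otimes> local.indexed_const l \<mu>) = local.indexed_const (k \<otimes> l)"
      using \<open>k \<in> carrier R\<close> by (auto simp: indexed_const_def)
    then show ?case using indexed_pset.indexed_const[of "k \<otimes> l" "carrier R" I] indexed_const \<open>k \<in> carrier R\<close>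
      by simp
  next
    case (indexed_padd P Q)
    then have "(\<lambda>\<mu>. k \<otimes> indexed_padd P Q \<mu>) = indexed_padd (\<lambda>\<mu>. k \<otimes> P \<mu>) (\<lambda>\<mu>. k \<otimes> Q \<mu>)"
      using \<open>k \<in> carrier R\<close> by (auto simp: indexed_padd_def r_distr carrier_coeff_def dest!: mpoly_carrier_coeff)
    then show ?case using indexed_padd by (simp add: indexed_pset.indexed_padd)
  next
    case (indexed_pmult P i)
    then have "(\<lambda>\<mu>. k \<otimes> indexed_pmult P i \<mu>) = indexed_pmult (\<lambda>\<mu>. k \<otimes> P \<mu>) i"
      using \<open>k \<in> carrier R\<close> by (auto simp: indexed_pmult_def)
    then show ?case using indexed_pmult by (simp add: indexed_pset.indexed_pmult)
  qed
  then show ?case using indexed_const assms(2) by (simp add: mpoly_mult_const mpoly_carrier_coeff)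
next
  case (indexed_padd P P')
  then show ?case using assms(2) assms(2)[THEN mpoly_carrier_coeff]
    by (simp add: mpoly_mult_add indexed_pset.indexed_padd indexed_padd(1,2)[THEN mpoly_carrier_coeff])
next
  case (indexed_pmult P i)
  then show ?case using assms(2) assms(2)[THEN mpoly_carrier_coeff]
    by (simp add: mpoly_mult_var indexed_pset.indexed_pmult indexed_pmult(1)[THEN mpoly_carrier_coeff])
qed

lemma mpoly_mult_assoc:
  assumes "P \<in> indexed_pset I (carrier R)" "carrier_coeff Q" "carrier_coeff S"
  shows "mpoly_mult R (mpoly_mult R P Q) S = mpoly_mult R P (mpoly_mult R Q S)"
  using assms(1)
proof induction
  case (indexed_const k)
  have "mpoly_mult R (\<lambda>\<mu>. k \<otimes> Q \<mu>) S \<mu> = k \<otimes> mpoly_mult R Q S \<mu>" for \<mu>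
    unfolding mpoly_mult_def using indexed_const assms(2,3) finite_submsets[of \<mu>]
    by (subst finsum_rdistr) (auto simp: carrier_coeff_def m_assoc intro!: add.finprod_cong')
  then show ?case using indexed_const assms(2,3)
    by (auto simp: mpoly_mult_const mpoly_mult_closed_coeff)
next
  case (indexed_padd P P')
  then show ?case using assms(2,3)
    by (simp add: mpoly_mult_add mpoly_mult_closed_coeff indexed_padd(1,2)[THEN mpoly_carrier_coeff])
next
  case (indexed_pmult P i)
  then show ?case using assms(2,3)
    by (simp add: mpoly_mult_var mpoly_mult_closed_coeff indexed_pmult(1)[THEN mpoly_carrier_coeff])
qed

lemma cring_mpoly_ring: "cring (mpoly_ring R m)"
proof (rule cringI)
  show "abelian_group (mpoly_ring R m)"
  proof (rule abelian_groupI)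
    fix P assume P: "P \<in> carrier (mpoly_ring R m)"
    let ?N = "mpoly_mult R (indexed_const (\<ominus> \<one>)) P"
    have "?N \<in> carrier (mpoly_ring R m)"
      using P by (auto simp: mpoly_ring_def intro: mpoly_mult_closed indexed_pset.indexed_const)
    moreover have "indexed_padd ?N P = indexed_const \<zero>"
      using P mpoly_carrier_coeff[of P "{..<m}"]
      by (auto simp: mpoly_ring_def mpoly_mult_const indexed_padd_def indexed_zero_def
          l_minus l_neg carrier_coeffE)
    ultimately show "\<exists>Q\<in>carrier (mpoly_ring R m). Q \<oplus>\<^bsub>mpoly_ring R m\<^esub> P = \<zero>\<^bsub>mpoly_ring R m\<^esub>"
      by (auto simp: mpoly_ring_def)
  next
    fix P Q assume PQ: "P \<in> carrier (mpoly_ring R m)" "Q \<in> carrier (mpoly_ring R m)"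
    then show "P \<oplus>\<^bsub>mpoly_ring R m\<^esub> Q \<in> carrier (mpoly_ring R m)"
      by (simp add: mpoly_ring_def indexed_pset.indexed_padd)
    from PQ show "P \<oplus>\<^bsub>mpoly_ring R m\<^esub> Q = Q \<oplus>\<^bsub>mpoly_ring R m\<^esub> P"
      by (auto simp: mpoly_ring_def indexed_padd_def a_comm carrier_coeff_def dest!: mpoly_carrier_coeff)
    fix S assume "S \<in> carrier (mpoly_ring R m)"
    with PQ show "P \<oplus>\<^bsub>mpoly_ring R m\<^esub> Q \<oplus>\<^bsub>mpoly_ring R m\<^esub> S =
        P \<oplus>\<^bsub>mpoly_ring R m\<^esub> (Q \<oplus>\<^bsub>mpoly_ring R m\<^esub> S)"
      by (auto simp: mpoly_ring_def indexed_padd_def a_assoc carrier_coeff_def dest!: mpoly_carrier_coeff)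
  qed (auto simp: mpoly_ring_def indexed_padd_zero mpoly_carrier_coeff indexed_pset.indexed_const)
  show "comm_monoid (mpoly_ring R m)"
    by (rule comm_monoidI)
      (auto simp: mpoly_ring_def mpoly_mult_closed mpoly_mult_assoc mpoly_mult_const
        mpoly_carrier_coeff mpoly_mult_comm carrier_coeffE
        intro: indexed_pset.indexed_const)
qed (auto simp: mpoly_ring_def mpoly_mult_add mpoly_carrier_coeff)

end
end

theory Submission
  imports Defs
begin

text \<open>Two sets of generators of \<open>I\<close> are related by maps of \<open>R\<close>-algebras between the polynomial rings
  that lift the identity of the Rees algebra, and the composite of the two maps is the identity
  modulo \<open>L\<close>; hence the conductor depends only on \<open>I\<close>, and the generators may be taken to be the
  homogeneous components of the given ones. Then \<open>T\<close> is graded with \<open>deg y\<^sub>i = deg f\<^sub>i\<close>, and the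
  projections \<open>\<pi>\<^sub>h\<close> onto its components preserve both \<open>J\<close> and \<open>L\<close>. For \<open>r \<in> C(I)\<close> and \<open>p \<in> J\<close>
  the element \<open>r\<^sub>g \<pi>\<^sub>h p = \<pi>\<^sub>g\<^sub>h (r \<pi>\<^sub>h p)\<close> lies in \<open>L\<close>, and summing over \<open>h\<close> gives \<open>r\<^sub>g p \<in> L\<close>.\<close>

section \<open>Evaluation of polynomials\<close>

text \<open>A grading of T in which every y_i is homogeneous and the Rees map preserves degrees asks
  for homogeneous f_i, whereas the conductor is defined from an arbitrary list; this forces the
  change of generators. There an arbitrary lift of the Rees map does not suffice: the difference
  between a variable and its image under the composite lies in J for any lift, but it has to lie in
  L. So variables are sent to linear forms, because a linear form in J is a linear relation. For the
  grading, J is the kernel of a map compatible with the projections, but L is given only by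
  generators. A projection is additive and not linear over T, so that passing from generators to L
  requires splitting multipliers into homogeneous constants and variables. Of the grading of T only
  the projections are used, together with the fact that a polynomial is the sum of its
  projections.\<close>

definition monomial_value :: "('b, 'm) monoid_scheme \<Rightarrow> ('c \<Rightarrow> 'b) \<Rightarrow> 'c multiset \<Rightarrow> 'b"
  where "monomial_value G x \<mu> = (\<Otimes>\<^bsub>G\<^esub>i\<in>set_mset \<mu>. x i [^]\<^bsub>G\<^esub> count \<mu> i)"

context comm_monoid begin

lemma monomial_value_closed:
  "x \<in> set_mset \<mu> \<rightarrow> carrier G \<Longrightarrow> monomial_value G x \<mu> \<in> carrier G"
  unfolding monomial_value_def by (intro finprod_closed) auto

lemma monomial_value_empty [simp]: "monomial_value G x {#} = \<one>"
  by (simp add: monomial_value_def)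

lemma monomial_value_add_mset:
  assumes "x \<in> insert i (set_mset \<mu>) \<rightarrow> carrier G"
  shows "monomial_value G x (add_mset i \<mu>) = x i \<otimes> monomial_value G x \<mu>"
proof -
  let ?rest = "\<Otimes>j\<in>set_mset \<mu> - {i}. x j [^] count \<mu> j"
  \<comment> \<open>The formula also covers an index i absent from \<open>\<nu>\<close>, where the
    exponent is 0 and the split-off factor is one; so it applies both to
    \<open>add_mset i \<mu>\<close> and to \<open>\<mu>\<close>.\<close>
  have split: "monomial_value G x \<nu> = x i [^] count \<nu> i \<otimes> (\<Otimes>j\<in>set_mset \<nu> - {i}. x j [^] count \<nu> j)"
    if "set_mset \<nu> \<subseteq> insert i (set_mset \<mu>)" for \<nu>
  proof (cases "i \<in># \<nu>")
    case True
    then have *: "set_mset \<nu> = insert i (set_mset \<nu> - {i})" by auto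
    show ?thesis unfolding monomial_value_def
      by (subst *, subst finprod_insert) (use assms that in auto)
  next
    case False
    then have "monomial_value G x \<nu> \<in> carrier G"
      using assms that by (intro monomial_value_closed) auto
    moreover have "count \<nu> i = 0" using False by (simp add: count_eq_zero_iff)
    ultimately show ?thesis using False by (simp add: monomial_value_def)
  qed
  have rest: "?rest \<in> carrier G" using assms by (intro finprod_closed) auto
  have "(\<Otimes>j\<in>set_mset (add_mset i \<mu>) - {i}. x j [^] count (add_mset i \<mu>) j) = ?rest"
    using assms by (intro finprod_cong') auto
  then have "monomial_value G x (add_mset i \<mu>) = x i [^] Suc (count \<mu> i) \<otimes> ?rest"
    using split[of "add_mset i \<mu>"] by auto
  also have "\<dots> = x i \<otimes> monomial_value G x \<mu>"
    using assms rest by (subst split) (auto simp: m_ac)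
  finally show ?thesis .
qed

end

section \<open>Induction, support and constants in the polynomial ring\<close>

context cring begin

lemma mpoly_const_closed: "k \<in> carrier R \<Longrightarrow> indexed_const k \<in> carrier (mpoly_ring R m)"
  by (simp add: mpoly_ring_def indexed_pset.indexed_const)

lemma mpoly_var_closed: "i < m \<Longrightarrow> indexed_var i \<in> carrier (mpoly_ring R m)"
  by (simp add: mpoly_ring_def indexed_var_def indexed_pset.indexed_const indexed_pset.indexed_pmult)

lemma mpoly_ring_coeff_closed: "P \<in> carrier (mpoly_ring R m) \<Longrightarrow> P \<mu> \<in> carrier R"
  by (auto simp: mpoly_ring_def intro: carrier_coeffE mpoly_carrier_coeff)

lemma mpoly_const_mult:
  "k \<in> carrier R \<Longrightarrow> P \<in> carrier (mpoly_ring R m) \<Longrightarrow>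
    indexed_const k \<otimes>\<^bsub>mpoly_ring R m\<^esub> P = (\<lambda>\<mu>. k \<otimes> P \<mu>)"
  by (simp add: mpoly_ring_def mpoly_mult_const mpoly_carrier_coeff)

lemma mpoly_var_mult:
  assumes "P \<in> carrier (mpoly_ring R m)"
  shows "indexed_var i \<otimes>\<^bsub>mpoly_ring R m\<^esub> P = indexed_pmult P i"
proof -
  have P: "carrier_coeff P" using assms by (auto simp: mpoly_ring_def intro: mpoly_carrier_coeff)
  then show ?thesis
    using mpoly_mult_var[of "indexed_const \<one>" P i] mpoly_mult_const[of \<one> P]
    by (simp add: mpoly_ring_def indexed_var_def carrier_coeff_def indexed_const_def)
qed

text \<open>The inductive definition of the carrier is recast in the ring operations of T, a left
  factor y_i replacing \<open>indexed_pmult\<close>. Homomorphism and projection laws then fit the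
  induction steps directly.\<close>

lemma mpoly_ring_induct [consumes 1, case_names const add var]:
  assumes "P \<in> carrier (mpoly_ring R m)"
    and "\<And>k. k \<in> carrier R \<Longrightarrow> Q (indexed_const k)"
    and "\<And>P P'. \<lbrakk>P \<in> carrier (mpoly_ring R m); P' \<in> carrier (mpoly_ring R m); Q P; Q P'\<rbrakk>
      \<Longrightarrow> Q (P \<oplus>\<^bsub>mpoly_ring R m\<^esub> P')"
    and "\<And>P i. \<lbrakk>P \<in> carrier (mpoly_ring R m); i < m; Q P\<rbrakk>
      \<Longrightarrow> Q (indexed_var i \<otimes>\<^bsub>mpoly_ring R m\<^esub> P)"
  shows "Q P"
proof -
  have car: "carrier (mpoly_ring R m) = indexed_pset {..<m} (carrier R)" by (simp add: mpoly_ring_def)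
  from assms(1) have "P \<in> indexed_pset {..<m} (carrier R)" by (simp add: car)
  then show ?thesis
  proof induction
    case (indexed_padd P Q)
    then show ?case using assms(3)[of P Q] by (simp add: mpoly_ring_def)
  next
    case (indexed_pmult P i)
    then show ?case using assms(4)[of P i] by (simp add: mpoly_var_mult car)
  qed (rule assms(2))
qed

text \<open>Finiteness makes the evaluation sums genuine, as \<open>finsum\<close> over an infinite
  set is zero by convention. The bound on the variables ensures that only values x i with i < m
  enter.\<close>

lemma mpoly_ring_support:
  assumes "P \<in> carrier (mpoly_ring R m)"
  shows "finite {\<mu>. P \<mu> \<noteq> \<zero>}" "P \<mu> \<noteq> \<zero> \<Longrightarrow> set_mset \<mu> \<subseteq> {..<m}"
proof -
  have "finite {\<mu>. P \<mu> \<noteq> \<zero>} \<and> (\<forall>\<mu>. P \<mu> \<noteq> \<zero> \<longrightarrow> set_mset \<mu> \<subseteq> {..<m})"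
    using assms
  proof (induction rule: mpoly_ring_induct)
    case (const k)
    have "finite {\<mu>. indexed_const k \<mu> \<noteq> \<zero>}"
      by (rule finite_subset[of _ "{{#}}"]) (auto simp: indexed_const_def)
    then show ?case by (auto simp: indexed_const_def)
  next
    case (add P P')
    have "{\<mu>. (P \<oplus>\<^bsub>mpoly_ring R m\<^esub> P') \<mu> \<noteq> \<zero>} \<subseteq> {\<mu>. P \<mu> \<noteq> \<zero>} \<union> {\<mu>. P' \<mu> \<noteq> \<zero>}"
      by (auto simp: mpoly_ring_def indexed_padd_def)
    with add.IH show ?case by (blast intro: finite_subset)
  next
    case (var P i)
    have "{\<mu>. indexed_pmult P i \<mu> \<noteq> \<zero>} \<subseteq> add_mset i ` {\<mu>. P \<mu> \<noteq> \<zero>}"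
    proof
      fix \<mu> assume "\<mu> \<in> {\<mu>. indexed_pmult P i \<mu> \<noteq> \<zero>}"
      then have "i \<in># \<mu>" "P (\<mu> - {#i#}) \<noteq> \<zero>" by (auto simp: indexed_pmult_def split: if_splits)
      then show "\<mu> \<in> add_mset i ` {\<mu>. P \<mu> \<noteq> \<zero>}" by (intro image_eqI[of _ _ "\<mu> - {#i#}"]) auto
    qed
    moreover have "finite (add_mset i ` {\<mu>. P \<mu> \<noteq> \<zero>})" using var.IH by blast
    moreover have "set_mset \<mu> \<subseteq> {..<m}" if *: "indexed_pmult P i \<mu> \<noteq> \<zero>" for \<mu>
    proof -
      have "i \<in># \<mu>" "P (\<mu> - {#i#}) \<noteq> \<zero>" using * by (auto simp: indexed_pmult_def split: if_splits)
      then have "set_mset (add_mset i (\<mu> - {#i#})) \<subseteq> {..<m}"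
        using var.IH \<open>i < m\<close> unfolding set_mset_add_mset_insert by blast
      then show ?thesis using \<open>i \<in># \<mu>\<close> by simp
    qed
    ultimately show ?case using var.hyps(1) by (auto simp: mpoly_var_mult dest: finite_subset)
  qed
  then show "finite {\<mu>. P \<mu> \<noteq> \<zero>}" "P \<mu> \<noteq> \<zero> \<Longrightarrow> set_mset \<mu> \<subseteq> {..<m}" by auto
qed

lemma mpoly_finsum_coeff:
  assumes "f \<in> A \<rightarrow> carrier (mpoly_ring R m)"
  shows "(\<Oplus>\<^bsub>mpoly_ring R m\<^esub>a\<in>A. f a) \<mu> = (\<Oplus>a\<in>A. f a \<mu>)"
proof -
  interpret T: cring "mpoly_ring R m" by (rule cring_mpoly_ring)
  show ?thesis using assms
  proof (induction A rule: infinite_finite_induct)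
    case (insert a A)
    then have "(\<lambda>a. f a \<mu>) \<in> A \<rightarrow> carrier R" "f a \<mu> \<in> carrier R"
      by (auto intro: mpoly_ring_coeff_closed)
    with insert show ?case
      by (auto simp: finsum_insert) (simp add: mpoly_ring_def indexed_padd_def)
  qed (simp_all, simp_all add: mpoly_ring_def indexed_zero_def)
qed

lemma mpoly_const_hom: "indexed_const \<in> ring_hom R (mpoly_ring R m)"
proof (rule ring_hom_memI)
  fix x y assume xy: "x \<in> carrier R" "y \<in> carrier R"
  then show "indexed_const (x \<otimes> y) = indexed_const x \<otimes>\<^bsub>mpoly_ring R m\<^esub> indexed_const y"
    by (subst mpoly_const_mult) (auto simp: mpoly_const_closed, auto simp: indexed_const_def)
  show "indexed_const (x \<oplus> y) = indexed_const x \<oplus>\<^bsub>mpoly_ring R m\<^esub> indexed_const y"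
    by (simp add: mpoly_ring_def indexed_padd_const)
qed (auto simp: mpoly_const_closed, simp add: mpoly_ring_def)

lemma ring_hom_cring_mpoly_const: "ring_hom_cring R (mpoly_ring R m) indexed_const"
  by (intro UnivPoly.ring_hom_cringI mpoly_const_hom cring_mpoly_ring is_cring)

end

text \<open>The target S is kept general because two instances are needed: \<open>UP R\<close>,
  which gives \<open>rees_map\<close>, and a second polynomial ring, which gives the change of
  generators.\<close>

definition mpoly_eval :: "('a, 'm) ring_scheme \<Rightarrow> ('b, 'n) ring_scheme \<Rightarrow> ('a \<Rightarrow> 'b) \<Rightarrow> (nat \<Rightarrow> 'b)
    \<Rightarrow> (nat multiset \<Rightarrow> 'a) \<Rightarrow> 'b"
  where "mpoly_eval R S h x p =
    (\<Oplus>\<^bsub>S\<^esub>\<mu>\<in>{\<mu>. p \<mu> \<noteq> \<zero>\<^bsub>R\<^esub>}. h (p \<mu>) \<otimes>\<^bsub>S\<^esub> monomial_value S x \<mu>)"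

context ring_hom_cring begin

context
  fixes m :: nat and x :: "nat \<Rightarrow> 'c"
  assumes x: "x \<in> {..<m} \<rightarrow> carrier S"
begin

text \<open>Terms with coefficient zero vanish, so the index set may be enlarged. Addition needs
  this to bring polynomials with different supports to a common index set.\<close>

lemma mpoly_eval_superset:
  assumes "P \<in> carrier (mpoly_ring R m)" "finite B" "{\<mu>. P \<mu> \<noteq> \<zero>\<^bsub>R\<^esub>} \<subseteq> B"
    "\<And>\<mu>. \<mu> \<in> B \<Longrightarrow> set_mset \<mu> \<subseteq> {..<m}"
  shows "mpoly_eval R S h x P = (\<Oplus>\<^bsub>S\<^esub>\<mu>\<in>B. h (P \<mu>) \<otimes>\<^bsub>S\<^esub> monomial_value S x \<mu>)"
proof -
  have "h (P \<mu>) \<otimes>\<^bsub>S\<^esub> monomial_value S x \<mu> \<in> carrier S" if "\<mu> \<in> B" for \<mu>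
    using assms(1) assms(4)[OF that] x
    by (intro S.m_closed hom_closed S.monomial_value_closed R.mpoly_ring_coeff_closed) auto
  moreover have "h (P \<mu>) \<otimes>\<^bsub>S\<^esub> monomial_value S x \<mu> = \<zero>\<^bsub>S\<^esub>" if "\<mu> \<in> B" "P \<mu> = \<zero>\<^bsub>R\<^esub>" for \<mu>
    using that assms(4)[OF that(1)] x
    by (subst \<open>P \<mu> = _\<close>, simp, intro S.l_null S.monomial_value_closed) auto
  ultimately show ?thesis unfolding mpoly_eval_def
    using assms by (intro S.add.finprod_mono_neutral_cong_left) auto
qed

lemma mpoly_eval_closed:
  assumes "P \<in> carrier (mpoly_ring R m)"
  shows "mpoly_eval R S h x P \<in> carrier S"
  unfolding mpoly_eval_def
proof (intro S.finsum_closed Pi_I S.m_closed hom_closed S.monomial_value_closed)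
  fix \<mu> i assume "\<mu> \<in> {\<mu>. P \<mu> \<noteq> \<zero>\<^bsub>R\<^esub>}" "i \<in># \<mu>"
  then show "x i \<in> carrier S" using R.mpoly_ring_support(2)[OF assms, of \<mu>] x by auto
qed (rule R.mpoly_ring_coeff_closed[OF assms])

lemma mpoly_eval_const:
  assumes "k \<in> carrier R" shows "mpoly_eval R S h x (R.indexed_const k) = h k"
proof -
  have "mpoly_eval R S h x (R.indexed_const k) =
      (\<Oplus>\<^bsub>S\<^esub>\<mu>\<in>{{#}}. h (R.indexed_const k \<mu>) \<otimes>\<^bsub>S\<^esub> monomial_value S x \<mu>)"
    using assms by (intro mpoly_eval_superset R.mpoly_const_closed) (auto simp: R.indexed_const_def)
  then show ?thesis using assms by (simp add: R.indexed_const_def)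
qed

lemma mpoly_eval_add:
  assumes P: "P \<in> carrier (mpoly_ring R m)" and Q: "Q \<in> carrier (mpoly_ring R m)"
  shows "mpoly_eval R S h x (P \<oplus>\<^bsub>mpoly_ring R m\<^esub> Q) =
    mpoly_eval R S h x P \<oplus>\<^bsub>S\<^esub> mpoly_eval R S h x Q"
proof -
  interpret T: cring "mpoly_ring R m" by (rule R.cring_mpoly_ring)
  let ?B = "{\<mu>. P \<mu> \<noteq> \<zero>\<^bsub>R\<^esub>} \<union> {\<mu>. Q \<mu> \<noteq> \<zero>\<^bsub>R\<^esub>}"
  have B: "finite ?B" "\<And>\<mu>. \<mu> \<in> ?B \<Longrightarrow> set_mset \<mu> \<subseteq> {..<m}"
    using R.mpoly_ring_support[OF P] R.mpoly_ring_support[OF Q] by auto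
  have eq: "(P \<oplus>\<^bsub>mpoly_ring R m\<^esub> Q) \<mu> = P \<mu> \<oplus>\<^bsub>R\<^esub> Q \<mu>" for \<mu>
    by (simp add: mpoly_ring_def R.indexed_padd_def)
  have val: "monomial_value S x \<mu> \<in> carrier S" if "\<mu> \<in> ?B" for \<mu>
    using B(2)[OF that] x by (intro S.monomial_value_closed) auto
  have "mpoly_eval R S h x (P \<oplus>\<^bsub>mpoly_ring R m\<^esub> Q) =
      (\<Oplus>\<^bsub>S\<^esub>\<mu>\<in>?B. h ((P \<oplus>\<^bsub>mpoly_ring R m\<^esub> Q) \<mu>) \<otimes>\<^bsub>S\<^esub> monomial_value S x \<mu>)"
    using B P Q by (intro mpoly_eval_superset) (auto simp: eq)
  also have "\<dots> = (\<Oplus>\<^bsub>S\<^esub>\<mu>\<in>?B. h (P \<mu>) \<otimes>\<^bsub>S\<^esub> monomial_value S x \<mu> \<oplus>\<^bsub>S\<^esub> h (Q \<mu>) \<otimes>\<^bsub>S\<^esub> monomial_value S x \<mu>)"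
    using P Q val by (intro S.add.finprod_cong')
      (auto simp: eq R.mpoly_ring_coeff_closed S.l_distr)
  also have "\<dots> = mpoly_eval R S h x P \<oplus>\<^bsub>S\<^esub> mpoly_eval R S h x Q"
    using mpoly_eval_superset[OF P B(1) _ B(2)] mpoly_eval_superset[OF Q B(1) _ B(2)] P Q val
    by (subst S.finsum_addf) (auto simp: R.mpoly_ring_coeff_closed)
  finally show ?thesis .
qed

text \<open>Multiplication by y_i moves the support along the injection \<open>add_mset i\<close>,
  so the sum can be reindexed, and each monomial value gains the factor x i.\<close>

lemma mpoly_eval_var_mult:
  assumes P: "P \<in> carrier (mpoly_ring R m)" and i: "i < m"
  shows "mpoly_eval R S h x (R.indexed_var i \<otimes>\<^bsub>mpoly_ring R m\<^esub> P) =
    x i \<otimes>\<^bsub>S\<^esub> mpoly_eval R S h x P"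
proof -
  interpret T: cring "mpoly_ring R m" by (rule R.cring_mpoly_ring)
  let ?B = "{\<mu>. P \<mu> \<noteq> \<zero>\<^bsub>R\<^esub>}" and ?Q = "R.indexed_var i \<otimes>\<^bsub>mpoly_ring R m\<^esub> P"
  have Q: "?Q \<in> carrier (mpoly_ring R m)" using assms R.mpoly_var_closed by auto
  have B: "finite ?B" "\<And>\<mu>. \<mu> \<in> ?B \<Longrightarrow> set_mset \<mu> \<subseteq> {..<m}"
    using R.mpoly_ring_support[OF P] by auto
  have eq: "?Q \<mu> = (if i \<in># \<mu> then P (\<mu> - {#i#}) else \<zero>\<^bsub>R\<^esub>)" for \<mu>
    using P by (simp add: R.mpoly_var_mult R.indexed_pmult_def)
  have val: "monomial_value S x \<mu> \<in> carrier S" if "\<mu> \<in> ?B" for \<mu>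
    using B(2)[OF that] x by (intro S.monomial_value_closed) auto
  have xi: "x i \<in> carrier S" using x i by auto
  have val_add: "monomial_value S x (add_mset i \<mu>) = x i \<otimes>\<^bsub>S\<^esub> monomial_value S x \<mu>" if "\<mu> \<in> ?B" for \<mu>
    using B(2)[OF that] x i by (intro S.monomial_value_add_mset) auto
  have "mpoly_eval R S h x ?Q = (\<Oplus>\<^bsub>S\<^esub>\<mu>\<in>add_mset i ` ?B. h (?Q \<mu>) \<otimes>\<^bsub>S\<^esub> monomial_value S x \<mu>)"
  proof (rule mpoly_eval_superset[OF Q])
    show "{\<mu>. ?Q \<mu> \<noteq> \<zero>\<^bsub>R\<^esub>} \<subseteq> add_mset i ` ?B"
    proof
      fix \<mu> assume "\<mu> \<in> {\<mu>. ?Q \<mu> \<noteq> \<zero>\<^bsub>R\<^esub>}"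
      then show "\<mu> \<in> add_mset i ` ?B"
        by (intro image_eqI[of _ _ "\<mu> - {#i#}"]) (auto simp: eq split: if_splits)
    qed
  next
    fix \<mu> assume "\<mu> \<in> add_mset i ` ?B"
    then obtain \<nu> where "\<nu> \<in> ?B" "\<mu> = add_mset i \<nu>" by blast
    then show "set_mset \<mu> \<subseteq> {..<m}" using B(2)[of \<nu>] i by simp
  qed (use B in simp)
  also have "\<dots> = (\<Oplus>\<^bsub>S\<^esub>\<mu>\<in>?B. h (?Q (add_mset i \<mu>)) \<otimes>\<^bsub>S\<^esub> monomial_value S x (add_mset i \<mu>))"
    using P xi val val_add by (intro S.add.finprod_reindex)
      (auto simp: inj_on_def eq R.mpoly_ring_coeff_closed)
  also have "\<dots> = (\<Oplus>\<^bsub>S\<^esub>\<mu>\<in>?B. x i \<otimes>\<^bsub>S\<^esub> (h (P \<mu>) \<otimes>\<^bsub>S\<^esub> monomial_value S x \<mu>))"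
    using P xi val val_add by (intro S.add.finprod_cong')
      (auto simp: eq R.mpoly_ring_coeff_closed S.m_lcomm)
  also have "\<dots> = x i \<otimes>\<^bsub>S\<^esub> mpoly_eval R S h x P"
    using P xi val B unfolding mpoly_eval_def
    by (subst S.finsum_rdistr) (auto simp: R.mpoly_ring_coeff_closed)
  finally show ?thesis .
qed

lemma mpoly_eval_var:
  assumes "i < m" shows "mpoly_eval R S h x (R.indexed_var i) = x i"
proof -
  interpret T: cring "mpoly_ring R m" by (rule R.cring_mpoly_ring)
  have "R.indexed_var i \<otimes>\<^bsub>mpoly_ring R m\<^esub> R.indexed_const \<one>\<^bsub>R\<^esub> = R.indexed_var i"
    using T.r_one[OF R.mpoly_var_closed[OF assms]] by (simp add: mpoly_ring_def)
  then show ?thesis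
    using mpoly_eval_var_mult[OF R.mpoly_const_closed[OF R.one_closed] assms] assms x
    by (simp add: mpoly_eval_const Pi_iff)
qed

lemma mpoly_eval_mult:
  assumes "P \<in> carrier (mpoly_ring R m)" and Q: "Q \<in> carrier (mpoly_ring R m)"
  shows "mpoly_eval R S h x (P \<otimes>\<^bsub>mpoly_ring R m\<^esub> Q) =
    mpoly_eval R S h x P \<otimes>\<^bsub>S\<^esub> mpoly_eval R S h x Q"
proof -
  interpret T: cring "mpoly_ring R m" by (rule R.cring_mpoly_ring)
  have xc: "i < m \<Longrightarrow> x i \<in> carrier S" for i using x by auto
  show ?thesis using assms(1)
  proof (induction rule: R.mpoly_ring_induct)
    case (const k)
    note k = this
    \<comment> \<open>\<open>mpoly_eval_const\<close> treats a bare constant only, so a constant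
      times Q needs an induction on Q of its own.\<close>
    have "mpoly_eval R S h x (R.indexed_const k \<otimes>\<^bsub>mpoly_ring R m\<^esub> Q) = h k \<otimes>\<^bsub>S\<^esub> mpoly_eval R S h x Q"
      using Q
    proof (induction rule: R.mpoly_ring_induct)
      case (const l)
      then show ?case using k ring_hom_mult[OF R.mpoly_const_hom k const, of m, symmetric]
        by (simp add: mpoly_eval_const)
    next
      case (add P P')
      then show ?case using k
        by (simp add: T.r_distr S.r_distr R.mpoly_const_closed mpoly_eval_add mpoly_eval_closed)
    next
      case (var P i)
      then have "R.indexed_const k \<otimes>\<^bsub>mpoly_ring R m\<^esub> (R.indexed_var i \<otimes>\<^bsub>mpoly_ring R m\<^esub> P) =
         R.indexed_var i \<otimes>\<^bsub>mpoly_ring R m\<^esub> (R.indexed_const k \<otimes>\<^bsub>mpoly_ring R m\<^esub> P)"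
        using k by (simp add: T.m_lcomm R.mpoly_const_closed R.mpoly_var_closed)
      then show ?case using var k
        by (simp add: mpoly_eval_var_mult S.m_lcomm R.mpoly_const_closed mpoly_eval_closed xc)
    qed
    then show ?case using k by (simp add: mpoly_eval_const)
  next
    case (add P P')
    then show ?case using Q
      by (simp add: T.l_distr S.l_distr mpoly_eval_add mpoly_eval_closed)
  next
    case (var P i)
    then show ?case using Q
      by (simp add: T.m_assoc S.m_assoc R.mpoly_var_closed mpoly_eval_var_mult mpoly_eval_closed xc)
  qed
qed

lemma mpoly_eval_hom: "ring_hom_cring (mpoly_ring R m) S (mpoly_eval R S h x)"
proof (intro UnivPoly.ring_hom_cringI R.cring_mpoly_ring S.is_cring ring_hom_memI)
  show "mpoly_eval R S h x \<one>\<^bsub>mpoly_ring R m\<^esub> = \<one>\<^bsub>S\<^esub>"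
    using mpoly_eval_const[of "\<one>\<^bsub>R\<^esub>"] by (simp add: mpoly_ring_def)
qed (simp_all add: mpoly_eval_closed mpoly_eval_mult mpoly_eval_add)

end

end

section \<open>Independence of the generators\<close>

lemma (in ring_hom_cring) ring_hom_ring: "ring_hom_ring R S h"
  by (intro ring_hom_ringI2 R.ring_axioms S.ring_axioms homh)

lemma (in ideal) finsum_mem: "f \<in> A \<rightarrow> I \<Longrightarrow> (\<Oplus>a\<in>A. f a) \<in> I"
  by (induction A rule: infinite_finite_induct)
    (auto simp: Pi_iff a_Hcarr intro: a_closed)

section \<open>Linear forms in the polynomial ring\<close>

definition linear_form :: "('a, 'm) ring_scheme \<Rightarrow> nat \<Rightarrow> (nat \<Rightarrow> 'a) \<Rightarrow> nat multiset \<Rightarrow> 'a"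
  where "linear_form R m a = (\<Oplus>\<^bsub>mpoly_ring R m\<^esub>i\<in>{..<m}.
    ring.indexed_const R (a i) \<otimes>\<^bsub>mpoly_ring R m\<^esub> ring.indexed_var R i)"

text \<open>This is the R-submodule of T spanned by the variables. Keeping it apart from the
  condition on the coefficients lets properties of linear relations be checked separately for this
  submodule and for J.\<close>

definition linear_forms :: "('a, 'm) ring_scheme \<Rightarrow> nat \<Rightarrow> (nat multiset \<Rightarrow> 'a) set"
  where "linear_forms R m = linear_form R m ` ({..<m} \<rightarrow> carrier R)"

context cring begin

lemma linear_form_closed:
  assumes "a \<in> {..<m} \<rightarrow> carrier R"
  shows "linear_form R m a \<in> carrier (mpoly_ring R m)"
proof -
  interpret T: cring "mpoly_ring R m" by (rule cring_mpoly_ring)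
  show ?thesis unfolding linear_form_def using assms
    by (intro T.finsum_closed) (auto simp: mpoly_const_closed mpoly_var_closed Pi_iff)
qed

lemma linear_forms_closed: "p \<in> linear_forms R m \<Longrightarrow> p \<in> carrier (mpoly_ring R m)"
  by (auto simp: linear_forms_def linear_form_closed)

lemma linear_forms_add:
  assumes "p \<in> linear_forms R m" "q \<in> linear_forms R m"
  shows "p \<oplus>\<^bsub>mpoly_ring R m\<^esub> q \<in> linear_forms R m"
proof -
  interpret T: cring "mpoly_ring R m" by (rule cring_mpoly_ring)
  interpret c: ring_hom_cring R "mpoly_ring R m" indexed_const by (rule ring_hom_cring_mpoly_const)
  obtain a b where ab: "a \<in> {..<m} \<rightarrow> carrier R" "p = linear_form R m a"
      "b \<in> {..<m} \<rightarrow> carrier R" "q = linear_form R m b"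
    using assms by (auto simp: linear_forms_def)
  have "p \<oplus>\<^bsub>mpoly_ring R m\<^esub> q = linear_form R m (\<lambda>i. a i \<oplus> b i)"
    unfolding ab linear_form_def using ab
    by (subst T.finsum_addf[symmetric])
      (auto simp: mpoly_var_closed Pi_iff T.l_distr simp del: T.finsum_addf T.add.finprod_multf intro!: T.finsum_cong')
  then show ?thesis using ab by (auto simp: linear_forms_def)
qed

lemma linear_forms_scale:
  assumes "k \<in> carrier R" "p \<in> linear_forms R m"
  shows "indexed_const k \<otimes>\<^bsub>mpoly_ring R m\<^esub> p \<in> linear_forms R m"
proof -
  interpret T: cring "mpoly_ring R m" by (rule cring_mpoly_ring)
  interpret c: ring_hom_cring R "mpoly_ring R m" indexed_const by (rule ring_hom_cring_mpoly_const)
  obtain a where a: "a \<in> {..<m} \<rightarrow> carrier R" "p = linear_form R m a"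
    using assms by (auto simp: linear_forms_def)
  have "indexed_const k \<otimes>\<^bsub>mpoly_ring R m\<^esub> p = linear_form R m (\<lambda>i. k \<otimes> a i)"
    unfolding a linear_form_def using a assms
    by (subst T.finsum_rdistr)
      (auto simp: mpoly_const_closed mpoly_var_closed Pi_iff T.m_assoc intro!: T.finsum_cong')
  then show ?thesis using a assms by (auto simp: linear_forms_def)
qed

lemma linear_forms_zero: "\<zero>\<^bsub>mpoly_ring R m\<^esub> \<in> linear_forms R m"
proof -
  interpret T: cring "mpoly_ring R m" by (rule cring_mpoly_ring)
  interpret c: ring_hom_cring R "mpoly_ring R m" indexed_const by (rule ring_hom_cring_mpoly_const)
  have "linear_form R m (\<lambda>_. \<zero>) = \<zero>\<^bsub>mpoly_ring R m\<^esub>"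
    unfolding linear_form_def by (intro T.add.finprod_one_eqI) (simp add: mpoly_var_closed)
  then show ?thesis unfolding linear_forms_def by (metis Pi_I imageI zero_closed)
qed

lemma linear_forms_uminus:
  assumes "p \<in> linear_forms R m"
  shows "\<ominus>\<^bsub>mpoly_ring R m\<^esub> p \<in> linear_forms R m"
proof -
  interpret T: cring "mpoly_ring R m" by (rule cring_mpoly_ring)
  interpret c: ring_hom_cring R "mpoly_ring R m" indexed_const by (rule ring_hom_cring_mpoly_const)
  show ?thesis
    using linear_forms_scale[of "\<ominus> \<one>" p m] assms linear_forms_closed[OF assms]
    by (simp add: T.l_minus)
qed

lemma linear_forms_var:
  assumes "i < m" shows "indexed_var i \<in> linear_forms R m"
proof -
  interpret T: cring "mpoly_ring R m" by (rule cring_mpoly_ring)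
  interpret c: ring_hom_cring R "mpoly_ring R m" indexed_const by (rule ring_hom_cring_mpoly_const)
  have "linear_form R m (\<lambda>j. if i = j then \<one> else \<zero>) =
      (\<Oplus>\<^bsub>mpoly_ring R m\<^esub>j\<in>{..<m}. if i = j then indexed_var j else \<zero>\<^bsub>mpoly_ring R m\<^esub>)"
    unfolding linear_form_def by (intro T.finsum_cong') (auto simp: mpoly_var_closed)
  also have "\<dots> = indexed_var i"
    using assms by (intro T.finsum_singleton) (auto simp: mpoly_var_closed)
  finally have eq: "linear_form R m (\<lambda>j. if i = j then \<one> else \<zero>) = indexed_var i" .
  show ?thesis unfolding linear_forms_def eq[symmetric] by (rule imageI) simp
qed

lemma linear_forms_finsum:
  assumes "f \<in> A \<rightarrow> linear_forms R m"
  shows "(\<Oplus>\<^bsub>mpoly_ring R m\<^esub>a\<in>A. f a) \<in> linear_forms R m"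
proof -
  interpret T: cring "mpoly_ring R m" by (rule cring_mpoly_ring)
  show ?thesis using assms
    by (induction A rule: infinite_finite_induct)
      (auto simp: linear_forms_zero linear_forms_add linear_forms_closed Pi_iff)
qed

lemma finsum_monom:
  assumes "f \<in> A \<rightarrow> carrier R"
  shows "(\<Oplus>\<^bsub>UP R\<^esub>a\<in>A. up_ring.monom (UP R) (f a) n) = up_ring.monom (UP R) (\<Oplus>a\<in>A. f a) n"
proof -
  interpret UP: UP_cring R "UP R" by (unfold_locales)
  show ?thesis using assms
    by (induction A rule: infinite_finite_induct) (auto simp: Pi_iff)
qed

section \<open>The Rees map, J, L and the conductor for a fixed list of generators\<close>

context
  fixes fs :: "'a list"
  assumes gens_closed: "set fs \<subseteq> carrier R"
begin

private abbreviation T where "T \<equiv> mpoly_ring R (length fs)"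

lemma gen_closed: "i < length fs \<Longrightarrow> fs ! i \<in> carrier R"
  using gens_closed by auto

lemma rees_map_eq_eval:
  "rees_map R fs = mpoly_eval R (UP R) (\<lambda>a. up_ring.monom (UP R) a 0) (\<lambda>i. up_ring.monom (UP R) (fs ! i) 1)"
  by (simp add: fun_eq_iff rees_map_def mpoly_eval_def monomial_value_def)

lemma const_monom_hom: "ring_hom_cring R (UP R) (\<lambda>a. up_ring.monom (UP R) a 0)"
proof -
  interpret UP: UP_cring R "UP R" by unfold_locales
  show ?thesis by (intro UnivPoly.ring_hom_cringI is_cring UP.P.is_cring UP.const_ring_hom)
qed

lemma monom_gens_closed: "(\<lambda>i. up_ring.monom (UP R) (fs ! i) 1) \<in> {..<length fs} \<rightarrow> carrier (UP R)"
proof -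
  interpret UP: UP_cring R "UP R" by unfold_locales
  show ?thesis by (simp add: gen_closed)
qed

lemma rees_map_hom: "ring_hom_cring T (UP R) (rees_map R fs)"
  unfolding rees_map_eq_eval
  by (rule ring_hom_cring.mpoly_eval_hom[OF const_monom_hom monom_gens_closed])

lemma rees_map_const: "k \<in> carrier R \<Longrightarrow> rees_map R fs (indexed_const k) = up_ring.monom (UP R) k 0"
  unfolding rees_map_eq_eval
  by (rule ring_hom_cring.mpoly_eval_const[OF const_monom_hom monom_gens_closed])

lemma rees_map_var: "i < length fs \<Longrightarrow> rees_map R fs (indexed_var i) = up_ring.monom (UP R) (fs ! i) 1"
  unfolding rees_map_eq_eval
  by (rule ring_hom_cring.mpoly_eval_var[OF const_monom_hom monom_gens_closed])

lemma rees_map_linear_form: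
  assumes "a \<in> {..<length fs} \<rightarrow> carrier R"
  shows "rees_map R fs (linear_form R (length fs) a) =
    up_ring.monom (UP R) (\<Oplus>i\<in>{..<length fs}. a i \<otimes> fs ! i) 1"
proof -
  interpret UP: UP_cring R "UP R" by unfold_locales
  interpret rees: ring_hom_cring T "UP R" "rees_map R fs" by (rule rees_map_hom)
  have mult: "up_ring.monom (UP R) k 0 \<otimes>\<^bsub>UP R\<^esub> up_ring.monom (UP R) x (Suc 0) = up_ring.monom (UP R) (k \<otimes> x) (Suc 0)"
    if "k \<in> carrier R" "x \<in> carrier R" for k x
    using UP.monom_mult[OF that, of 0 1] by simp
  have "rees_map R fs (linear_form R (length fs) a) =
      (\<Oplus>\<^bsub>UP R\<^esub>i\<in>{..<length fs}. up_ring.monom (UP R) (a i \<otimes> fs ! i) 1)"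
    unfolding linear_form_def using assms
    by (subst rees.hom_finsum)
      (auto simp: mpoly_const_closed mpoly_var_closed Pi_iff rees_map_const rees_map_var gen_closed
        mult simp del: UP.monom_mult intro!: UP.P.finsum_cong')
  also have "\<dots> = up_ring.monom (UP R) (\<Oplus>i\<in>{..<length fs}. a i \<otimes> fs ! i) 1"
    using assms by (intro finsum_monom) (auto simp: Pi_iff gen_closed)
  finally show ?thesis .
qed

text \<open>\<open>rees_algebra\<close> alters only the carrier of \<open>UP R\<close>, and a kernel
  sees only the zero of its codomain. So J is a kernel into \<open>UP R\<close>, and no ring
  structure on the Rees algebra has to be established.\<close>

lemma rees_ideal_iff: "p \<in> rees_ideal R fs \<longleftrightarrow> p \<in> carrier T \<and> rees_map R fs p = \<zero>\<^bsub>UP R\<^esub>"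
  unfolding rees_ideal_def rees_algebra_def a_kernel_def' by simp

lemma ideal_rees_ideal: "ideal (rees_ideal R fs) T"
proof -
  interpret rees: ring_hom_cring T "UP R" "rees_map R fs" by (rule rees_map_hom)
  have "rees_ideal R fs = a_kernel T (UP R) (rees_map R fs)"
    unfolding rees_ideal_def rees_algebra_def a_kernel_def' by simp
  then show ?thesis
    using ring_hom_ring.kernel_is_ideal[OF rees.ring_hom_ring] by argo
qed

text \<open>By \<open>rees_map_linear_form\<close> the image of a linear form is a monomial of
  degree one in t whose coefficient is the sum of the a_i f_i, and a monomial of fixed degree
  determines its coefficient.\<close>

lemma linear_relations_eq: "linear_relations R fs = linear_forms R (length fs) \<inter> rees_ideal R fs"
proof -
  interpret UP: UP_cring R "UP R" by unfold_locales
  have "linear_form R (length fs) a \<in> rees_ideal R fs \<longleftrightarrow>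
      (\<Oplus>i\<in>{..<length fs}. a i \<otimes> fs ! i) = \<zero>" if "a \<in> {..<length fs} \<rightarrow> carrier R" for a
  proof -
    have c: "(\<Oplus>i\<in>{..<length fs}. a i \<otimes> fs ! i) \<in> carrier R"
      using that by (intro finsum_closed) (auto simp: Pi_iff gen_closed)
    have "up_ring.monom (UP R) \<zero> 1 = \<zero>\<^bsub>UP R\<^esub>" by simp
    then have "up_ring.monom (UP R) (\<Oplus>i\<in>{..<length fs}. a i \<otimes> fs ! i) 1 = \<zero>\<^bsub>UP R\<^esub> \<longleftrightarrow>
        (\<Oplus>i\<in>{..<length fs}. a i \<otimes> fs ! i) = \<zero>"
      using inj_on_eq_iff[OF UP.monom_inj[of 1] c zero_closed] by metis
    then show ?thesis
      unfolding rees_ideal_iff rees_map_linear_form[OF that] using linear_form_closed[OF that] by blast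
  qed
  then show ?thesis
    unfolding linear_relations_def linear_forms_def linear_form_def[symmetric] by blast
qed

lemma linear_relations_closed: "linear_relations R fs \<subseteq> carrier T"
  by (auto simp: linear_relations_eq linear_forms_closed)

lemma ideal_linear_ideal: "ideal (linear_ideal R fs) T"
  unfolding linear_ideal_def
  by (rule ring.genideal_ideal[OF cring.axioms(1)[OF cring_mpoly_ring] linear_relations_closed])

lemma linear_relation_in_linear_ideal: "p \<in> linear_relations R fs \<Longrightarrow> p \<in> linear_ideal R fs"
  unfolding linear_ideal_def 
  using ring.genideal_self[OF cring.axioms(1)[OF cring_mpoly_ring] linear_relations_closed] by blast

text \<open>The elements r for which r t is the image of a linear form make up an ideal
  \<open>?I\<close> that contains every generator. This supplies the images of the variables under a
  change of generators.\<close>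

lemma genideal_imp_linear_form:
  assumes "r \<in> Idl (set fs)"
  shows "\<exists>p\<in>linear_forms R (length fs). rees_map R fs p = up_ring.monom (UP R) r 1"
proof -
  interpret UP: UP_cring R "UP R" by unfold_locales
  interpret rees: ring_hom_cring T "UP R" "rees_map R fs" by (rule rees_map_hom)
  interpret c: ring_hom_cring R T indexed_const by (rule ring_hom_cring_mpoly_const)
  let ?I = "{r \<in> carrier R. \<exists>p\<in>linear_forms R (length fs). rees_map R fs p = up_ring.monom (UP R) r 1}"
  have scale: "x \<otimes> a \<in> ?I" if a: "a \<in> ?I" and x: "x \<in> carrier R" for a x
  proof -
    obtain p where p: "p \<in> linear_forms R (length fs)" "rees_map R fs p = up_ring.monom (UP R) a 1"
      using a by blast
    have "rees_map R fs (indexed_const x \<otimes>\<^bsub>T\<^esub> p) = up_ring.monom (UP R) (x \<otimes> a) 1"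
      using p x a UP.monom_mult[of x a 0 1]
      by (simp add: linear_forms_closed rees_map_const mpoly_const_closed del: UP.monom_mult)
    then show ?thesis using x a linear_forms_scale[OF x p(1)] by auto
  qed
  have "ideal ?I R"
  proof (rule idealI)
    show "subgroup ?I (add_monoid R)"
    proof (rule add.subgroupI)
      have "rees_map R fs \<zero>\<^bsub>T\<^esub> = up_ring.monom (UP R) \<zero> 1" by simp
      then show "?I \<noteq> {}" using linear_forms_zero by blast
    next
      fix a assume a: "a \<in> ?I"
      then show "\<ominus> a \<in> ?I" using scale[OF a, of "\<ominus> \<one>"] by (simp add: l_minus)
    next
      fix a b assume "a \<in> ?I" "b \<in> ?I"
      then obtain p q where pq: "a \<in> carrier R" "p \<in> linear_forms R (length fs)" "rees_map R fs p = up_ring.monom (UP R) a 1"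
         "b \<in> carrier R" "q \<in> linear_forms R (length fs)" "rees_map R fs q = up_ring.monom (UP R) b 1"
        by blast
      then have "rees_map R fs (p \<oplus>\<^bsub>T\<^esub> q) = up_ring.monom (UP R) (a \<oplus> b) 1"
        by (simp add: linear_forms_closed)
      then show "a \<oplus> b \<in> ?I" using pq linear_forms_add[OF pq(2,5)] by auto
    qed auto
    fix a x assume "a \<in> ?I" "x \<in> carrier R"
    then show "x \<otimes> a \<in> ?I" "a \<otimes> x \<in> ?I" using scale[of a x] by (simp_all add: m_comm)
  qed (rule ring_axioms)
  moreover have "set fs \<subseteq> ?I"
    using rees_map_var linear_forms_var gen_closed by (fastforce simp: in_set_conv_nth)
  ultimately show ?thesis using genideal_minimal assms by blast
qed

lemma conductor_iff:
  "r \<in> conductor R fs \<longleftrightarrow>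
    r \<in> carrier R \<and> (\<forall>p\<in>rees_ideal R fs. indexed_const r \<otimes>\<^bsub>T\<^esub> p \<in> linear_ideal R fs)"
  by (auto simp: conductor_def)

lemma ideal_conductor: "ideal (conductor R fs) R"
proof -
  interpret T: cring T by (rule cring_mpoly_ring)
  interpret c: ring_hom_cring R T indexed_const by (rule ring_hom_cring_mpoly_const)
  interpret L: ideal "linear_ideal R fs" T by (rule ideal_linear_ideal)
  interpret J: ideal "rees_ideal R fs" T by (rule ideal_rees_ideal)
  have scale: "x \<otimes> a \<in> conductor R fs" if "a \<in> conductor R fs" "x \<in> carrier R" for a x
    using that L.I_l_closed by (auto simp: conductor_iff T.m_assoc J.a_Hcarr)
  show ?thesis
  proof (rule idealI)
    show "subgroup (conductor R fs) (add_monoid R)"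
    proof (rule add.subgroupI)
      have "\<zero> \<in> conductor R fs" by (simp add: conductor_iff J.a_Hcarr)
      then show "conductor R fs \<noteq> {}" by blast
    next
      fix a assume a: "a \<in> conductor R fs"
      then show "\<ominus> a \<in> conductor R fs" using scale[OF a, of "\<ominus> \<one>"] by (simp add: l_minus conductor_iff)
    next
      fix a b assume "a \<in> conductor R fs" "b \<in> conductor R fs"
      then show "a \<oplus> b \<in> conductor R fs"
        by (auto simp: conductor_iff T.l_distr J.a_Hcarr)
    qed (auto simp: conductor_iff)
    fix a x assume "a \<in> conductor R fs" "x \<in> carrier R"
    then show "x \<otimes> a \<in> conductor R fs" "a \<otimes> x \<in> conductor R fs"
      using scale[of a x] by (simp_all add: m_comm conductor_iff)
  qed (rule ring_axioms)
qed

end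

text \<open>Expressing the generators \<open>fs\<close> through \<open>gs\<close> gives a map of \<open>R\<close>-algebras between the two
  polynomial rings that lifts the identity of the Rees algebra.\<close>

lemma change_of_generators:
  assumes fs: "set fs \<subseteq> carrier R" and gs: "set gs \<subseteq> carrier R"
    and sub: "set fs \<subseteq> Idl (set gs)"
  obtains \<psi> where "ring_hom_cring (mpoly_ring R (length fs)) (mpoly_ring R (length gs)) \<psi>"
    and "\<And>k. k \<in> carrier R \<Longrightarrow> \<psi> (indexed_const k) = indexed_const k"
    and "\<And>p. p \<in> linear_forms R (length fs) \<Longrightarrow> \<psi> p \<in> linear_forms R (length gs)"
    and "\<And>p. p \<in> carrier (mpoly_ring R (length fs)) \<Longrightarrow> rees_map R gs (\<psi> p) = rees_map R fs p"
proof -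
  let ?S = "mpoly_ring R (length fs)" and ?T = "mpoly_ring R (length gs)"
  interpret T: cring ?T by (rule cring_mpoly_ring)
  interpret rees: ring_hom_cring ?T "UP R" "rees_map R gs" by (rule rees_map_hom[OF gs])
  interpret rees_fs: ring_hom_cring ?S "UP R" "rees_map R fs" by (rule rees_map_hom[OF fs])
  \<comment> \<open>Arbitrary preimages of the f_i t would also give a lift of the Rees map; linear
    ones are chosen so that linear forms go to linear forms.\<close>
  have "\<forall>i\<in>{..<length fs}. \<exists>p\<in>linear_forms R (length gs). rees_map R gs p = up_ring.monom (UP R) (fs ! i) 1"
    using genideal_imp_linear_form[OF gs] subsetD[OF sub nth_mem] by blast
  then obtain x where x: "\<And>i. i < length fs \<Longrightarrow> x i \<in> linear_forms R (length gs)"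
      "\<And>i. i < length fs \<Longrightarrow> rees_map R gs (x i) = up_ring.monom (UP R) (fs ! i) 1"
    by (metis lessThan_iff)
  have xc: "x \<in> {..<length fs} \<rightarrow> carrier ?T"
    using x(1) linear_forms_closed by auto
  interpret c: ring_hom_cring R ?T indexed_const by (rule ring_hom_cring_mpoly_const)
  let ?\<psi> = "mpoly_eval R ?T indexed_const x"
  interpret \<psi>: ring_hom_cring ?S ?T ?\<psi> by (rule c.mpoly_eval_hom[OF xc])
  note const = c.mpoly_eval_const[OF xc] and var = c.mpoly_eval_var[OF xc]
  show ?thesis
  proof (rule that[of ?\<psi>])
    fix p assume "p \<in> linear_forms R (length fs)"
    then obtain a where a: "a \<in> {..<length fs} \<rightarrow> carrier R" "p = linear_form R (length fs) a"
      by (auto simp: linear_forms_def)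
    then have "?\<psi> p = (\<Oplus>\<^bsub>?T\<^esub>i\<in>{..<length fs}. indexed_const (a i) \<otimes>\<^bsub>?T\<^esub> x i)"
      unfolding a(2) linear_form_def using xc
      by (subst \<psi>.hom_finsum)
        (auto simp: mpoly_const_closed mpoly_var_closed Pi_iff const var intro!: T.finsum_cong')
    then show "?\<psi> p \<in> linear_forms R (length gs)"
      using a x(1) by (auto intro!: linear_forms_finsum linear_forms_scale)
  next
    fix p assume "p \<in> carrier ?S"
    then show "rees_map R gs (?\<psi> p) = rees_map R fs p"
    proof (induction rule: mpoly_ring_induct)
      case (var P i)
      then show ?case using xc x
        by (auto simp: mpoly_var_closed c.mpoly_eval_var[OF xc] rees_map_var[OF fs] Pi_iff)
    qed (simp_all add: const rees_map_const[OF fs] rees_map_const[OF gs])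
  qed (use \<psi>.ring_hom_cring_axioms const in auto)
qed

text \<open>The preimage of an ideal under \<open>\<psi>\<close> is an ideal, so it is enough to
  know where the generators of L go.\<close>

lemma hom_linear_ideal:
  assumes fs: "set fs \<subseteq> carrier R" and gs: "set gs \<subseteq> carrier R"
    and "ring_hom_cring (mpoly_ring R (length fs)) (mpoly_ring R (length gs)) \<psi>"
    and "\<And>p. p \<in> linear_relations R fs \<Longrightarrow> \<psi> p \<in> linear_relations R gs"
    and "p \<in> linear_ideal R fs"
  shows "\<psi> p \<in> linear_ideal R gs"
proof -
  let ?S = "mpoly_ring R (length fs)" and ?T = "mpoly_ring R (length gs)"
  interpret \<psi>: ring_hom_cring ?S ?T \<psi> by fact
  have "ideal {q \<in> carrier ?S. \<psi> q \<in> linear_ideal R gs} ?S"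
    by (rule ring_hom_ring.ideal_vimage[OF \<psi>.ring_hom_ring ideal_linear_ideal[OF gs]])
  then have "linear_ideal R fs \<subseteq> {q \<in> carrier ?S. \<psi> q \<in> linear_ideal R gs}"
    unfolding linear_ideal_def[of R fs]
    using assms(4) linear_relations_closed[OF fs] linear_relation_in_linear_ideal[OF gs]
    by (intro ring.genideal_minimal[OF \<psi>.R.ring_axioms]) auto
  then show ?thesis using assms(5) by blast
qed

text \<open>Let r be in the conductor of fs and p in the ideal J of gs. Then r
  \<open>\<phi>\<close>(p) lies in the ideal L of fs, \<open>\<psi>\<close> carries it to r
  \<open>\<psi>\<close>(\<open>\<phi>\<close>(p)) in the ideal L of gs, and this differs from r p by
  an element of that ideal. The opposite inclusion follows by symmetry.\<close>

lemma conductor_subset: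
  assumes fs: "set fs \<subseteq> carrier R" and gs: "set gs \<subseteq> carrier R"
    and eq: "Idl (set fs) = Idl (set gs)"
  shows "conductor R fs \<subseteq> conductor R gs"
proof
  fix r assume r: "r \<in> conductor R fs"
  let ?S = "mpoly_ring R (length fs)" and ?T = "mpoly_ring R (length gs)"
  interpret T: cring ?T by (rule cring_mpoly_ring)
  interpret rees: ring_hom_cring ?T "UP R" "rees_map R gs" by (rule rees_map_hom[OF gs])
  interpret L: ideal "linear_ideal R gs" ?T by (rule ideal_linear_ideal[OF gs])
  have sub: "set fs \<subseteq> Idl (set gs)" "set gs \<subseteq> Idl (set fs)"
    using genideal_self[OF fs] genideal_self[OF gs] eq by auto
  obtain \<psi> where \<psi>: "ring_hom_cring ?S ?T \<psi>"
      "\<And>k. k \<in> carrier R \<Longrightarrow> \<psi> (indexed_const k) = indexed_const k"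
      "\<And>p. p \<in> linear_forms R (length fs) \<Longrightarrow> \<psi> p \<in> linear_forms R (length gs)"
      "\<And>p. p \<in> carrier ?S \<Longrightarrow> rees_map R gs (\<psi> p) = rees_map R fs p"
    using change_of_generators[OF fs gs sub(1)] by metis
  obtain \<phi> where \<phi>: "ring_hom_cring ?T ?S \<phi>"
      "\<And>k. k \<in> carrier R \<Longrightarrow> \<phi> (indexed_const k) = indexed_const k"
      "\<And>p. p \<in> linear_forms R (length gs) \<Longrightarrow> \<phi> p \<in> linear_forms R (length fs)"
      "\<And>p. p \<in> carrier ?T \<Longrightarrow> rees_map R fs (\<phi> p) = rees_map R gs p"
    using change_of_generators[OF gs fs sub(2)] by metis
  interpret \<psi>: ring_hom_cring ?S ?T \<psi> by fact
  interpret \<phi>: ring_hom_cring ?T ?S \<phi> by fact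
  have \<psi>_linear: "\<psi> p \<in> linear_ideal R gs" if "p \<in> linear_ideal R fs" for p
  proof (rule hom_linear_ideal[OF fs gs \<psi>(1) _ that])
    fix q assume "q \<in> linear_relations R fs"
    then show "\<psi> q \<in> linear_relations R gs"
      using \<psi>(3,4) by (auto simp: linear_relations_eq[OF fs] linear_relations_eq[OF gs]
        rees_ideal_iff[OF fs] rees_ideal_iff[OF gs] linear_forms_closed)
  qed
  have diff: "\<psi> (\<phi> p) \<ominus>\<^bsub>?T\<^esub> p \<in> linear_ideal R gs" if "p \<in> carrier ?T" for p
    using that
  proof (induction rule: mpoly_ring_induct)
    case (const k)
    then show ?case by (simp add: \<phi>(2) \<psi>(2) mpoly_const_closed T.minus_eq T.r_neg)
  next
    case (add P Q)
    let ?P = "\<psi> (\<phi> P)" and ?Q = "\<psi> (\<phi> Q)"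
    have "\<psi> (\<phi> (P \<oplus>\<^bsub>?T\<^esub> Q)) \<ominus>\<^bsub>?T\<^esub> (P \<oplus>\<^bsub>?T\<^esub> Q) =
        (?P \<ominus>\<^bsub>?T\<^esub> P) \<oplus>\<^bsub>?T\<^esub> (?Q \<ominus>\<^bsub>?T\<^esub> Q)"
      using add.hyps by (simp add: T.minus_eq T.minus_add T.a_ac)
    then show ?case using add.IH by simp
  next
    case (var P i)
    let ?P = "\<psi> (\<phi> P)" and ?y = "indexed_var i"
    have y: "?y \<in> carrier ?T" "?y \<in> linear_forms R (length gs)"
      using var.hyps by (simp_all add: mpoly_var_closed linear_forms_var)
    \<comment> \<open>The difference is a linear form, and the Rees map kills it because both maps
      commute with the Rees maps; so it is a generator of L and not merely an element of J.\<close>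
    have "\<psi> (\<phi> ?y) \<ominus>\<^bsub>?T\<^esub> ?y \<in> linear_relations R gs"
      using y \<phi>(3,4) \<psi>(3,4)
      by (simp add: linear_relations_eq[OF gs] rees_ideal_iff[OF gs] T.minus_eq linear_forms_add
          linear_forms_uminus rees.hom_a_inv rees.S.r_neg)
    then have "\<psi> (\<phi> ?y) \<ominus>\<^bsub>?T\<^esub> ?y \<in> linear_ideal R gs"
      by (rule linear_relation_in_linear_ideal[OF gs])
    \<comment> \<open>This is a b - c d = (a - c) b + c (b - d): the first summand is in L by the
      case of the variable, the second by the induction hypothesis.\<close>
    moreover have "\<psi> (\<phi> (?y \<otimes>\<^bsub>?T\<^esub> P)) \<ominus>\<^bsub>?T\<^esub> ?y \<otimes>\<^bsub>?T\<^esub> P =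
        (\<psi> (\<phi> ?y) \<ominus>\<^bsub>?T\<^esub> ?y) \<otimes>\<^bsub>?T\<^esub> ?P \<oplus>\<^bsub>?T\<^esub> ?y \<otimes>\<^bsub>?T\<^esub> (?P \<ominus>\<^bsub>?T\<^esub> P)"
      using y(1) var.hyps(1) \<psi>.hom_closed[OF \<phi>.hom_closed[OF y(1)]] \<psi>.hom_closed[OF \<phi>.hom_closed[OF var.hyps(1)]]
      by (simp, algebra)
    moreover have "?P \<in> carrier ?T" using var.hyps(1) by simp
    ultimately show ?case
      using L.a_closed[OF L.I_r_closed L.I_l_closed[OF var.IH y(1)]] by simp
  qed
  have rc: "r \<in> carrier R" using r by (simp add: conductor_iff[OF fs])
  have "indexed_const r \<otimes>\<^bsub>?T\<^esub> p \<in> linear_ideal R gs" if p: "p \<in> rees_ideal R gs" for p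
  proof -
    have pc: "p \<in> carrier ?T" using p by (simp add: rees_ideal_iff[OF gs])
    have cc: "indexed_const r \<in> carrier ?T" "indexed_const r \<in> carrier ?S"
      using rc by (simp_all add: mpoly_const_closed)
    have "\<phi> p \<in> rees_ideal R fs" using p \<phi>(4) by (simp add: rees_ideal_iff[OF fs] rees_ideal_iff[OF gs])
    then have "\<psi> (indexed_const r \<otimes>\<^bsub>?S\<^esub> \<phi> p) \<in> linear_ideal R gs"
      using r \<psi>_linear by (simp add: conductor_iff[OF fs])
    then have 1: "indexed_const r \<otimes>\<^bsub>?T\<^esub> \<psi> (\<phi> p) \<in> linear_ideal R gs"
      using cc pc rc by (simp add: \<psi>(2))
    have 2: "indexed_const r \<otimes>\<^bsub>?T\<^esub> (\<psi> (\<phi> p) \<ominus>\<^bsub>?T\<^esub> p) \<in> linear_ideal R gs"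
      by (rule L.I_l_closed[OF diff[OF pc] cc(1)])
    have "indexed_const r \<otimes>\<^bsub>?T\<^esub> p = indexed_const r \<otimes>\<^bsub>?T\<^esub> \<psi> (\<phi> p) \<ominus>\<^bsub>?T\<^esub>
        indexed_const r \<otimes>\<^bsub>?T\<^esub> (\<psi> (\<phi> p) \<ominus>\<^bsub>?T\<^esub> p)"
      using cc pc \<psi>.hom_closed[OF \<phi>.hom_closed[OF pc]] by algebra
    then show ?thesis using 1 2 by (simp add: T.minus_eq)
  qed
  with rc show "r \<in> conductor R gs" by (simp add: conductor_iff[OF gs])
qed

end

section \<open>Gradings\<close>

context graded_ring begin

definition component :: "'c \<Rightarrow> 'a \<Rightarrow> 'a"
  where "component g r = (THE c. homogeneous_decomposition R G A r c) g"

lemma homogeneous_closed: "a \<in> A g \<Longrightarrow> g \<in> carrier G \<Longrightarrow> a \<in> carrier R"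
  using component_subgroup additive_subgroup.a_Hcarr by metis

lemma zero_homogeneous: "g \<in> carrier G \<Longrightarrow> \<zero> \<in> A g"
  using component_subgroup additive_subgroup.zero_closed by metis

lemma homogeneous_decomposition_component:
  assumes "r \<in> carrier R"
  shows "homogeneous_decomposition R G A r (\<lambda>g. component g r)"
proof -
  have "(\<lambda>g. component g r) = (THE c. homogeneous_decomposition R G A r c)"
    by (simp add: component_def)
  then show ?thesis using theI'[OF direct_sum[OF assms]] by simp
qed

lemma component_homogeneous: "r \<in> carrier R \<Longrightarrow> g \<in> carrier G \<Longrightarrow> component g r \<in> A g"
  using homogeneous_decomposition_component by (force simp: homogeneous_decomposition_def)

lemma component_closed: "r \<in> carrier R \<Longrightarrow> g \<in> carrier G \<Longrightarrow> component g r \<in> carrier R"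
  using component_homogeneous homogeneous_closed by blast

lemma finite_support_component: "r \<in> carrier R \<Longrightarrow> finite {g \<in> carrier G. component g r \<noteq> \<zero>}"
  using homogeneous_decomposition_component by (force simp: homogeneous_decomposition_def)

lemma finsum_component:
  assumes "r \<in> carrier R" "finite H" "H \<subseteq> carrier G" "{g \<in> carrier G. component g r \<noteq> \<zero>} \<subseteq> H"
  shows "(\<Oplus>g\<in>H. component g r) = r"
proof -
  have "r = (\<Oplus>g\<in>{g \<in> carrier G. component g r \<noteq> \<zero>}. component g r)"
    using homogeneous_decomposition_component[OF assms(1)] unfolding homogeneous_decomposition_def
    by blast
  also have "\<dots> = (\<Oplus>g\<in>H. component g r)"
    using assms component_closed by (intro R.add.finprod_mono_neutral_cong_left) auto
  finally show ?thesis ..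
qed

lemma component_eqI:
  assumes H: "finite H" "H \<subseteq> carrier G" and c: "\<And>g. g \<in> H \<Longrightarrow> c g \<in> A g"
    and r: "r = (\<Oplus>g\<in>H. c g)" and g: "g \<in> carrier G"
  shows "component g r = (if g \<in> H then c g else \<zero>)"
proof -
  \<comment> \<open>Uniqueness is stated for functions that are extensional on
    \<open>carrier G\<close>, so c is extended by zero outside H and then restricted.\<close>
  define d where "d = restrict (\<lambda>g. if g \<in> H then c g else \<zero>) (carrier G)"
  have cc: "c h \<in> carrier R" if "h \<in> H" for h
    using c[OF that] H(2) that homogeneous_closed by blast
  then have rc: "r \<in> carrier R" unfolding r by (intro R.finsum_closed) auto
  have "{h \<in> carrier G. d h \<noteq> \<zero>} \<subseteq> H" by (auto simp: d_def)
  moreover have "r = (\<Oplus>h\<in>{h \<in> carrier G. d h \<noteq> \<zero>}. d h)"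
    unfolding r using H cc
    by (intro R.add.finprod_mono_neutral_cong_right) (auto simp: d_def)
  moreover have "d \<in> (\<Pi>\<^sub>E g\<in>carrier G. A g)"
    using c zero_homogeneous by (auto simp: d_def)
  ultimately have "homogeneous_decomposition R G A r d"
    using finite_subset[OF _ H(1)] unfolding homogeneous_decomposition_def by blast
  then have "(\<lambda>h. component h r) = d"
    using direct_sum[OF rc] homogeneous_decomposition_component[OF rc] by blast
  then have "component g r = d g" by (rule fun_cong)
  then show ?thesis using g by (simp add: d_def)
qed

text \<open>This form suits families given by one formula in all degrees, with H only an upper bound
  for the support; the result is then free of a case distinction.\<close>

lemma component_eqI_full:
  assumes H: "finite H" "H \<subseteq> carrier G" and c: "\<And>g. g \<in> carrier G \<Longrightarrow> c g \<in> A g"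
    and "\<And>g. g \<in> carrier G - H \<Longrightarrow> c g = \<zero>"
    and "r = (\<Oplus>g\<in>H. c g)" and "g \<in> carrier G"
  shows "component g r = c g"
  using component_eqI[OF H, of c r g] assms by (cases "g \<in> H") auto

lemma component_of_homogeneous:
  assumes "a \<in> A g" "g \<in> carrier G" "h \<in> carrier G"
  shows "component h a = (if h = g then a else \<zero>)"
  using component_eqI[of "{g}" "\<lambda>_. a" a h] assms homogeneous_closed by simp

lemma component_zero: "g \<in> carrier G \<Longrightarrow> component g \<zero> = \<zero>"
  using component_of_homogeneous[OF zero_homogeneous, of g g] by simp

lemma component_add:
  assumes "r \<in> carrier R" "s \<in> carrier R" "g \<in> carrier G"
  shows "component g (r \<oplus> s) = component g r \<oplus> component g s"
proof -
  let ?H = "{g \<in> carrier G. component g r \<noteq> \<zero>} \<union> {g \<in> carrier G. component g s \<noteq> \<zero>}"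
  have H: "finite ?H" "?H \<subseteq> carrier G" using assms finite_support_component by auto
  have "(\<Oplus>g\<in>?H. component g r \<oplus> component g s) = (\<Oplus>g\<in>?H. component g r) \<oplus> (\<Oplus>g\<in>?H. component g s)"
    using assms H component_closed by (intro R.finsum_addf) auto
  also have "(\<Oplus>g\<in>?H. component g r) = r" using assms H by (intro finsum_component) auto
  also have "(\<Oplus>g\<in>?H. component g s) = s" using assms H by (intro finsum_component) auto
  finally have "r \<oplus> s = (\<Oplus>g\<in>?H. component g r \<oplus> component g s)" ..
  then show ?thesis
    using assms H component_homogeneous additive_subgroup.a_closed[OF component_subgroup]
    by (intro component_eqI_full[of ?H "\<lambda>g. component g r \<oplus> component g s"]) auto
qed

text \<open>Multiplication by a carries degree k to g k. Translation by g is injective, so the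
  translated components of r still sit in distinct degrees and, by uniqueness, are the components of
  the product.\<close>

lemma component_homogeneous_mult:
  assumes "a \<in> A g" "g \<in> carrier G" "r \<in> carrier R" "h \<in> carrier G"
  shows "component h (a \<otimes> r) = a \<otimes> component (inv\<^bsub>G\<^esub> g \<otimes>\<^bsub>G\<^esub> h) r"
proof -
  let ?S = "{k \<in> carrier G. component k r \<noteq> \<zero>}"
  let ?c = "\<lambda>l. a \<otimes> component (inv\<^bsub>G\<^esub> g \<otimes>\<^bsub>G\<^esub> l) r"
  have S: "finite ?S" using assms finite_support_component by auto
  have a: "a \<in> carrier R" using assms homogeneous_closed by blast
  have cancel: "inv\<^bsub>G\<^esub> g \<otimes>\<^bsub>G\<^esub> (g \<otimes>\<^bsub>G\<^esub> k) = k" "g \<otimes>\<^bsub>G\<^esub> (inv\<^bsub>G\<^esub> g \<otimes>\<^bsub>G\<^esub> k) = k"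
    if "k \<in> carrier G" for k
    using assms that by (simp_all flip: G.m_assoc)
  have "a \<otimes> r = a \<otimes> (\<Oplus>k\<in>?S. component k r)"
    using assms S by (subst finsum_component) auto
  also have "\<dots> = (\<Oplus>k\<in>?S. a \<otimes> component k r)"
    using a S assms component_closed by (intro R.finsum_rdistr) auto
  also have "\<dots> = (\<Oplus>k\<in>?S. ?c (g \<otimes>\<^bsub>G\<^esub> k))"
    using a assms component_closed by (intro R.finsum_cong') (auto simp: cancel)
  also have "\<dots> = (\<Oplus>l\<in>(\<lambda>k. g \<otimes>\<^bsub>G\<^esub> k) ` ?S. ?c l)"
    using a assms component_closed
    by (intro R.add.finprod_reindex[symmetric]) (auto simp: cancel intro!: inj_onI)
  finally have sum: "a \<otimes> r = (\<Oplus>l\<in>(\<lambda>k. g \<otimes>\<^bsub>G\<^esub> k) ` ?S. ?c l)" .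
  show ?thesis
  proof (rule component_eqI_full[OF _ _ _ _ sum assms(4)])
    show "finite ((\<lambda>k. g \<otimes>\<^bsub>G\<^esub> k) ` ?S)" using S by simp
    show "(\<lambda>k. g \<otimes>\<^bsub>G\<^esub> k) ` ?S \<subseteq> carrier G" using assms by auto
  next
    fix l assume l: "l \<in> carrier G"
    then have "?c l \<in> A (g \<otimes>\<^bsub>G\<^esub> (inv\<^bsub>G\<^esub> g \<otimes>\<^bsub>G\<^esub> l))"
      using assms by (intro component_mult component_homogeneous) auto
    then show "?c l \<in> A l" using l by (simp add: cancel)
  next
    fix l assume l: "l \<in> carrier G - (\<lambda>k. g \<otimes>\<^bsub>G\<^esub> k) ` ?S"
    have "inv\<^bsub>G\<^esub> g \<otimes>\<^bsub>G\<^esub> l \<notin> ?S"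
    proof
      assume "inv\<^bsub>G\<^esub> g \<otimes>\<^bsub>G\<^esub> l \<in> ?S"
      then have "g \<otimes>\<^bsub>G\<^esub> (inv\<^bsub>G\<^esub> g \<otimes>\<^bsub>G\<^esub> l) \<in> (\<lambda>k. g \<otimes>\<^bsub>G\<^esub> k) ` ?S" by (rule imageI)
      then show False using l cancel(2)[of l] by simp
    qed
    then have "component (inv\<^bsub>G\<^esub> g \<otimes>\<^bsub>G\<^esub> l) r = \<zero>" using l assms by auto
    then show "?c l = \<zero>" using a by simp
  qed
qed

text \<open>With \<open>deg y\<^sub>i = e i\<close> the polynomial ring is graded by \<open>G\<close> as well; \<open>mpoly_component\<close> is the
  projection onto the homogeneous polynomials of degree \<open>h\<close>. Monomials in foreign variables, whose
  degree may be meaningless, are sent to zero.\<close>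

definition mpoly_component :: "nat \<Rightarrow> (nat \<Rightarrow> 'c) \<Rightarrow> 'c \<Rightarrow> (nat multiset \<Rightarrow> 'a) \<Rightarrow> nat multiset \<Rightarrow> 'a"
  where "mpoly_component m e h p = (\<lambda>\<mu>. if set_mset \<mu> \<subseteq> {..<m}
    then component (h \<otimes>\<^bsub>G\<^esub> inv\<^bsub>G\<^esub> monomial_value G e \<mu>) (p \<mu>) else \<zero>)"

context
  fixes m :: nat and e :: "nat \<Rightarrow> 'c"
  assumes e: "e \<in> {..<m} \<rightarrow> carrier G"
begin

private abbreviation T where "T \<equiv> mpoly_ring R m"
private abbreviation deg where "deg \<equiv> monomial_value G e"

lemma degree_closed: "set_mset \<mu> \<subseteq> {..<m} \<Longrightarrow> deg \<mu> \<in> carrier G"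
  using e by (intro G.monomial_value_closed) auto

lemma degree_add_mset: "set_mset \<mu> \<subseteq> {..<m} \<Longrightarrow> i < m \<Longrightarrow> deg (add_mset i \<mu>) = e i \<otimes>\<^bsub>G\<^esub> deg \<mu>"
  using e by (intro G.monomial_value_add_mset) auto

lemma mpoly_component_const:
  "k \<in> carrier R \<Longrightarrow> h \<in> carrier G \<Longrightarrow>
    mpoly_component m e h (R.indexed_const k) = R.indexed_const (component h k)"
  by (auto simp: fun_eq_iff mpoly_component_def R.indexed_const_def component_zero degree_closed)

lemma mpoly_component_add:
  assumes "p \<in> carrier T" "q \<in> carrier T" "h \<in> carrier G"
  shows "mpoly_component m e h (p \<oplus>\<^bsub>T\<^esub> q) = mpoly_component m e h p \<oplus>\<^bsub>T\<^esub> mpoly_component m e h q"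
proof -
  have "(p \<oplus>\<^bsub>T\<^esub> q) = (\<lambda>\<mu>. p \<mu> \<oplus> q \<mu>)" for p q
    by (simp add: mpoly_ring_def R.indexed_padd_def fun_eq_iff)
  then show ?thesis using assms
    by (simp add: fun_eq_iff mpoly_component_def component_add R.mpoly_ring_coeff_closed[of _ m] degree_closed)
qed

text \<open>Multiplication by y_i keeps the coefficients and multiplies the degree of every monomial
  by e i. Degree h of the product therefore comes from degree (e i)^-1 h of p.\<close>

lemma mpoly_component_pmult:
  assumes "p \<in> carrier T" "i < m" "h \<in> carrier G"
  shows "mpoly_component m e h (R.indexed_pmult p i) =
    R.indexed_pmult (mpoly_component m e (inv\<^bsub>G\<^esub> e i \<otimes>\<^bsub>G\<^esub> h) p) i"
proof
  fix \<mu>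
  have ei: "e i \<in> carrier G" using e assms by auto
  show "mpoly_component m e h (R.indexed_pmult p i) \<mu> =
    R.indexed_pmult (mpoly_component m e (inv\<^bsub>G\<^esub> e i \<otimes>\<^bsub>G\<^esub> h) p) i \<mu>"
  proof (cases "i \<in># \<mu>")
    case False
    then show ?thesis using assms
      by (simp add: mpoly_component_def R.indexed_pmult_def component_zero degree_closed)
  next
    case True
    then obtain \<nu> where \<nu>: "\<mu> = add_mset i \<nu>" by (metis mset_add)
    have "h \<otimes>\<^bsub>G\<^esub> inv\<^bsub>G\<^esub> deg \<mu> = inv\<^bsub>G\<^esub> e i \<otimes>\<^bsub>G\<^esub> h \<otimes>\<^bsub>G\<^esub> inv\<^bsub>G\<^esub> deg \<nu>"
      if "set_mset \<nu> \<subseteq> {..<m}"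
      using that ei assms degree_closed[OF that]
      by (simp add: \<nu> degree_add_mset G.inv_mult_group G.m_ac)
    then show ?thesis using assms by (simp add: mpoly_component_def R.indexed_pmult_def \<nu>)
  qed
qed

lemma mpoly_component_closed:
  assumes "p \<in> carrier T" "h \<in> carrier G"
  shows "mpoly_component m e h p \<in> carrier T"
  using assms
\<comment> \<open>The degree must vary, because the variable case calls the induction hypothesis at
  the shifted degree.\<close>
proof (induction arbitrary: h rule: R.mpoly_ring_induct)
  case (const k)
  then show ?case by (simp add: mpoly_component_const R.mpoly_const_closed component_closed)
next
  case (add p q)
  interpret T: cring T by (rule R.cring_mpoly_ring)
  show ?case using add by (simp add: mpoly_component_add)
next
  case (var p i)
  interpret T: cring T by (rule R.cring_mpoly_ring)
  have "inv\<^bsub>G\<^esub> e i \<otimes>\<^bsub>G\<^esub> h \<in> carrier G" using var e by auto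
  then have c: "mpoly_component m e (inv\<^bsub>G\<^esub> e i \<otimes>\<^bsub>G\<^esub> h) p \<in> carrier T" by (rule var.IH)
  have "R.indexed_var i \<otimes>\<^bsub>T\<^esub> mpoly_component m e (inv\<^bsub>G\<^esub> e i \<otimes>\<^bsub>G\<^esub> h) p \<in> carrier T"
    using c var.hyps by (simp add: R.mpoly_var_closed)
  then show ?case using var.hyps var.prems c
    by (simp add: R.mpoly_var_mult mpoly_component_pmult)
qed

lemma mpoly_component_var_mult:
  assumes "p \<in> carrier T" "i < m" "h \<in> carrier G"
  shows "mpoly_component m e h (R.indexed_var i \<otimes>\<^bsub>T\<^esub> p) =
    R.indexed_var i \<otimes>\<^bsub>T\<^esub> mpoly_component m e (inv\<^bsub>G\<^esub> e i \<otimes>\<^bsub>G\<^esub> h) p"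
proof -
  have "inv\<^bsub>G\<^esub> e i \<otimes>\<^bsub>G\<^esub> h \<in> carrier G" using assms e by auto
  then show ?thesis using assms
    by (simp add: R.mpoly_var_mult mpoly_component_pmult mpoly_component_closed)
qed

lemma mpoly_component_homogeneous_mult:
  assumes "a \<in> A g" "g \<in> carrier G" "p \<in> carrier T" "h \<in> carrier G"
  shows "mpoly_component m e h (R.indexed_const a \<otimes>\<^bsub>T\<^esub> p) =
    R.indexed_const a \<otimes>\<^bsub>T\<^esub> mpoly_component m e (inv\<^bsub>G\<^esub> g \<otimes>\<^bsub>G\<^esub> h) p"
proof -
  have a: "a \<in> carrier R" using assms homogeneous_closed by blast
  have gh: "inv\<^bsub>G\<^esub> g \<otimes>\<^bsub>G\<^esub> h \<in> carrier G" using assms by simp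
  show ?thesis
    using a assms R.mpoly_ring_coeff_closed[OF assms(3)] degree_closed
    by (simp add: R.mpoly_const_mult mpoly_component_closed[OF assms(3) gh])
      (auto simp: fun_eq_iff mpoly_component_def component_homogeneous_mult G.m_assoc)
qed

text \<open>The coefficient of the projection at \<open>\<mu>\<close> is homogeneous of degree h
  deg(\<open>\<mu>\<close>)^-1. So \<open>component_homogeneous_mult\<close> applies with this
  coefficient as the homogeneous factor and r as the arbitrary one, which isolates the component of
  r of degree g.\<close>

lemma mpoly_component_mult_homogeneous:
  assumes "r \<in> carrier R" "p \<in> carrier T" "g \<in> carrier G" "h \<in> carrier G"
  shows "mpoly_component m e (g \<otimes>\<^bsub>G\<^esub> h) (R.indexed_const r \<otimes>\<^bsub>T\<^esub> mpoly_component m e h p) =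
    R.indexed_const (component g r) \<otimes>\<^bsub>T\<^esub> mpoly_component m e h p"
proof -
  let ?q = "mpoly_component m e h p"
  have q: "?q \<in> carrier T" using assms by (simp add: mpoly_component_closed)
  have "component (g \<otimes>\<^bsub>G\<^esub> h \<otimes>\<^bsub>G\<^esub> inv\<^bsub>G\<^esub> deg \<mu>) (r \<otimes> ?q \<mu>) = component g r \<otimes> ?q \<mu>"
    if \<mu>: "set_mset \<mu> \<subseteq> {..<m}" for \<mu>
  proof -
    let ?k = "h \<otimes>\<^bsub>G\<^esub> inv\<^bsub>G\<^esub> deg \<mu>"
    have d: "deg \<mu> \<in> carrier G" using \<mu> by (rule degree_closed)
    then have k: "?k \<in> carrier G" using assms by simp
    have hom: "?q \<mu> \<in> A ?k"
      using \<mu> k R.mpoly_ring_coeff_closed[OF assms(2)] by (simp add: mpoly_component_def component_homogeneous)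
    have qc: "?q \<mu> \<in> carrier R" using hom k homogeneous_closed by blast
    have e1: "g \<otimes>\<^bsub>G\<^esub> h \<otimes>\<^bsub>G\<^esub> inv\<^bsub>G\<^esub> deg \<mu> = ?k \<otimes>\<^bsub>G\<^esub> g"
      using assms d by (simp add: G.m_ac)
    have e2: "inv\<^bsub>G\<^esub> ?k \<otimes>\<^bsub>G\<^esub> (?k \<otimes>\<^bsub>G\<^esub> g) = g"
      using assms k G.m_assoc[of "inv\<^bsub>G\<^esub> ?k" ?k g] G.l_inv[OF k] G.l_one[OF assms(3)] by simp
    have "component (?k \<otimes>\<^bsub>G\<^esub> g) (?q \<mu> \<otimes> r) = ?q \<mu> \<otimes> component g r"
      using component_homogeneous_mult[OF hom k assms(1), of "?k \<otimes>\<^bsub>G\<^esub> g"] k assms(3) e2 by simp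
    then show ?thesis
      unfolding e1 using R.m_comm[OF qc assms(1)] R.m_comm[OF qc component_closed[OF assms(1,3)]] by simp
  qed
  moreover have "?q \<mu> = \<zero>" if "\<not> set_mset \<mu> \<subseteq> {..<m}" for \<mu>
    unfolding mpoly_component_def using that by simp
  ultimately show ?thesis
    using q assms
    by (simp add: R.mpoly_const_mult component_closed, subst mpoly_component_def)
      (auto simp: fun_eq_iff component_closed)
qed

lemma sum_mpoly_component:
  assumes p: "p \<in> carrier T"
  obtains H where "finite H" "H \<subseteq> carrier G" "p = (\<Oplus>\<^bsub>T\<^esub>h\<in>H. mpoly_component m e h p)"
proof
  let ?S = "{\<mu>. p \<mu> \<noteq> \<zero>}" and ?K = "\<lambda>\<mu>. {k \<in> carrier G. component k (p \<mu>) \<noteq> \<zero>}"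
  \<comment> \<open>These are the total degrees k deg(\<open>\<mu>\<close>) of the nonzero
    homogeneous parts of p; there are finitely many, since p has finitely many monomials and each
    coefficient finitely many components.\<close>
  let ?H = "\<Union>\<mu>\<in>?S. (\<lambda>k. k \<otimes>\<^bsub>G\<^esub> deg \<mu>) ` ?K \<mu>"
  note supp = R.mpoly_ring_support[OF p] and coeff = R.mpoly_ring_coeff_closed[OF p]
  show H: "finite ?H" using supp(1) finite_support_component coeff by blast
  show HG: "?H \<subseteq> carrier G" using degree_closed supp(2) by auto
  have mc: "mpoly_component m e h p \<in> carrier T" if "h \<in> ?H" for h
    using that HG p mpoly_component_closed by blast
  show "p = (\<Oplus>\<^bsub>T\<^esub>h\<in>?H. mpoly_component m e h p)"
  proof
    fix \<mu>
    have "(\<Oplus>\<^bsub>T\<^esub>h\<in>?H. mpoly_component m e h p) \<mu> = (\<Oplus>h\<in>?H. mpoly_component m e h p \<mu>)"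
      using mc by (intro R.mpoly_finsum_coeff) blast
    also have "\<dots> = p \<mu>"
    proof (cases "p \<mu> = \<zero>")
      case True
      have "mpoly_component m e h p \<mu> = \<zero>" if "h \<in> ?H" for h
      proof -
        have "h \<in> carrier G" using that HG by blast
        then show ?thesis using degree_closed by (simp add: mpoly_component_def True component_zero)
      qed
      then show ?thesis unfolding True by (rule R.add.finprod_one_eqI)
    next
      case False
      then have \<mu>: "set_mset \<mu> \<subseteq> {..<m}" by (rule supp(2))
      then have d: "deg \<mu> \<in> carrier G" by (rule degree_closed)
      \<comment> \<open>For fixed \<open>\<mu>\<close> this translation is injective, and the image
        of \<open>?H\<close> contains every degree in which the coefficient at \<open>\<mu>\<close>
        has a nonzero component. Reindexing thus turns the sum over \<open>?H\<close> into the
        decomposition of that coefficient.\<close>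
      let ?f = "\<lambda>h. h \<otimes>\<^bsub>G\<^esub> inv\<^bsub>G\<^esub> deg \<mu>"
      have inj: "inj_on ?f ?H"
      proof (rule inj_onI)
        fix h k assume "h \<in> ?H" "k \<in> ?H" "?f h = ?f k"
        then show "h = k" using HG d G.right_cancel[of "inv\<^bsub>G\<^esub> deg \<mu>" h k] by blast
      qed
      have sub: "?f ` ?H \<subseteq> carrier G" using HG d by blast
      have "?K \<mu> \<subseteq> ?f ` ?H"
      proof
        fix k assume k: "k \<in> ?K \<mu>"
        then have "k \<otimes>\<^bsub>G\<^esub> deg \<mu> \<in> ?H" using False by blast
        moreover have "k = ?f (k \<otimes>\<^bsub>G\<^esub> deg \<mu>)" using k d by (simp add: G.m_assoc)
        ultimately show "k \<in> ?f ` ?H" by (rule rev_image_eqI)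
      qed
      then have "(\<Oplus>k\<in>?f ` ?H. component k (p \<mu>)) = p \<mu>"
        using finsum_component[OF coeff finite_imageI[OF H] sub] by blast
      moreover have "(\<Oplus>k\<in>?f ` ?H. component k (p \<mu>)) = (\<Oplus>h\<in>?H. component (?f h) (p \<mu>))"
        using sub component_closed[OF coeff] by (intro R.add.finprod_reindex[OF _ inj]) blast
      moreover have "mpoly_component m e h p \<mu> = component (?f h) (p \<mu>)" for h
        using \<mu> by (simp add: mpoly_component_def)
      ultimately show ?thesis by simp
    qed
    finally show "p \<mu> = (\<Oplus>\<^bsub>T\<^esub>h\<in>?H. mpoly_component m e h p) \<mu>" ..
  qed
qed

lemma mpoly_component_finsum:
  assumes "f \<in> B \<rightarrow> carrier T" "h \<in> carrier G"
  shows "mpoly_component m e h (\<Oplus>\<^bsub>T\<^esub>b\<in>B. f b) = (\<Oplus>\<^bsub>T\<^esub>b\<in>B. mpoly_component m e h (f b))"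
proof -
  interpret T: cring T by (rule R.cring_mpoly_ring)
  have zero: "mpoly_component m e h \<zero>\<^bsub>T\<^esub> = \<zero>\<^bsub>T\<^esub>"
    using mpoly_component_const[OF R.zero_closed assms(2)] assms(2)
    by (simp add: mpoly_ring_def component_zero)
  show ?thesis using assms(1)
    by (induction B rule: infinite_finite_induct)
      (auto simp: zero mpoly_component_add mpoly_component_closed assms(2) Pi_iff)
qed

text \<open>The term a_i y_i is projected to b y_i, where b is the component of a_i of degree (e
  i)^-1 h, so linearity survives.\<close>

lemma mpoly_component_linear_form:
  assumes "p \<in> linear_forms R m" "h \<in> carrier G"
  shows "mpoly_component m e h p \<in> linear_forms R m"
proof -
  interpret T: cring T by (rule R.cring_mpoly_ring)
  obtain a where a: "a \<in> {..<m} \<rightarrow> carrier R" "p = linear_form R m a"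
    using assms by (auto simp: linear_forms_def)
  have "mpoly_component m e h p =
      (\<Oplus>\<^bsub>T\<^esub>i\<in>{..<m}. mpoly_component m e h (R.indexed_const (a i) \<otimes>\<^bsub>T\<^esub> R.indexed_var i))"
    unfolding a(2) linear_form_def using a(1) assms(2)
    by (intro mpoly_component_finsum) (auto simp: R.mpoly_const_closed R.mpoly_var_closed Pi_iff)
  moreover have "mpoly_component m e h (R.indexed_const (a i) \<otimes>\<^bsub>T\<^esub> R.indexed_var i) \<in> linear_forms R m"
    if i: "i < m" for i
  proof -
    have c: "R.indexed_const (a i) \<in> carrier T" "a i \<in> carrier R" "R.indexed_var i \<in> carrier T"
      using a i by (auto simp: R.mpoly_const_closed R.mpoly_var_closed Pi_iff)
    have g: "inv\<^bsub>G\<^esub> e i \<otimes>\<^bsub>G\<^esub> h \<in> carrier G" using e i assms by auto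
    have cc: "component (inv\<^bsub>G\<^esub> e i \<otimes>\<^bsub>G\<^esub> h) (a i) \<in> carrier R" using c g component_closed by blast
    have "mpoly_component m e h (R.indexed_const (a i) \<otimes>\<^bsub>T\<^esub> R.indexed_var i) =
        R.indexed_const (component (inv\<^bsub>G\<^esub> e i \<otimes>\<^bsub>G\<^esub> h) (a i)) \<otimes>\<^bsub>T\<^esub> R.indexed_var i"
      using T.m_comm[OF c(1,3)] mpoly_component_var_mult[OF c(1) i assms(2)]
        mpoly_component_const[OF c(2) g] T.m_comm[OF c(3) R.mpoly_const_closed[OF cc]] by simp
    then show ?thesis using R.linear_forms_scale[OF cc R.linear_forms_var[OF i]] by simp
  qed
  ultimately show ?thesis by (auto intro!: R.linear_forms_finsum)
qed

end

text \<open>If \<open>f\<^sub>i\<close> has degree \<open>e i\<close> and \<open>t\<close> the neutral degree, then \<open>\<phi>\<close> preserves degrees.\<close>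

context
  fixes fs :: "'a list" and e :: "nat \<Rightarrow> 'c"
  assumes e: "e \<in> {..<length fs} \<rightarrow> carrier G"
    and homogeneous: "i < length fs \<Longrightarrow> fs ! i \<in> A (e i)"
begin

private abbreviation S where "S \<equiv> mpoly_ring R (length fs)"
private abbreviation comp where "comp \<equiv> mpoly_component (length fs) e"

lemma homogeneous_gens_closed: "set fs \<subseteq> carrier R"
proof
  fix f assume "f \<in> set fs"
  then obtain i where i: "i < length fs" "f = fs ! i" by (auto simp: in_set_conv_nth)
  then have "e i \<in> carrier G" using e by blast
  with i show "f \<in> carrier R" using homogeneous_closed[OF homogeneous[OF i(1)]] by blast
qed

lemma coeff_rees_map_component:
  assumes "p \<in> carrier S" "h \<in> carrier G"
  shows "up_ring.coeff (UP R) (rees_map R fs (comp h p)) n =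
    component h (up_ring.coeff (UP R) (rees_map R fs p) n)"
  using assms
\<comment> \<open>Both h and n vary: a factor y_i shifts the degree by e i and the power of t by
  one.\<close>
proof (induction arbitrary: h n rule: R.mpoly_ring_induct)
  case (const k)
  interpret UP: UP_cring R "UP R" by unfold_locales
  show ?case using const
    by (simp add: mpoly_component_const[OF e] R.rees_map_const[OF homogeneous_gens_closed]
        component_closed component_zero)
next
  case (add p q)
  interpret UP: UP_cring R "UP R" by unfold_locales
  interpret rees: ring_hom_cring S "UP R" "rees_map R fs"
    by (rule R.rees_map_hom[OF homogeneous_gens_closed])
  show ?case using add
    by (simp add: mpoly_component_add[OF e] mpoly_component_closed[OF e] component_add)
next
  case (var p i)
  interpret UP: UP_cring R "UP R" by unfold_locales
  interpret rees: ring_hom_cring S "UP R" "rees_map R fs"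
    by (rule R.rees_map_hom[OF homogeneous_gens_closed])
  let ?k = "inv\<^bsub>G\<^esub> e i \<otimes>\<^bsub>G\<^esub> h"
  have ei: "e i \<in> carrier G" and k: "?k \<in> carrier G" using e var by auto
  have fi: "fs ! i \<in> carrier R" using homogeneous_gens_closed var by auto
  have y: "R.indexed_var i \<in> carrier S" using var by (simp add: R.mpoly_var_closed)
  \<comment> \<open>Since y_i goes to f_i t, a factor y_i multiplies the coefficients by f_i and
    moves them up by one; the constant coefficient becomes zero, hence the case n = 0.\<close>
  have shift: "up_ring.coeff (UP R) (rees_map R fs (R.indexed_var i \<otimes>\<^bsub>S\<^esub> q)) n =
      (if n = 0 then \<zero> else fs ! i \<otimes> up_ring.coeff (UP R) (rees_map R fs q) (n - 1))"
    if q: "q \<in> carrier S" for q n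
  proof -
    have c: "rees_map R fs q \<in> carrier (UP R)" using q by simp
    have eq: "rees_map R fs (R.indexed_var i \<otimes>\<^bsub>S\<^esub> q) =
        up_ring.monom (UP R) (fs ! i) 1 \<otimes>\<^bsub>UP R\<^esub> rees_map R fs q"
      using q y var R.rees_map_var[OF homogeneous_gens_closed] by simp
    show ?thesis
    proof (cases n)
      case 0
      then show ?thesis unfolding eq using c fi by simp
    next
      case (Suc l)
      then show ?thesis unfolding eq using UP.coeff_monom_mult[OF fi c, of 1 l] by simp
    qed
  qed
  have cp: "comp ?k p \<in> carrier S" using var k by (simp add: mpoly_component_closed[OF e])
  have eq: "comp h (R.indexed_var i \<otimes>\<^bsub>S\<^esub> p) = R.indexed_var i \<otimes>\<^bsub>S\<^esub> comp ?k p"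
    using var by (simp add: mpoly_component_var_mult[OF e])
  have pc: "up_ring.coeff (UP R) (rees_map R fs p) l \<in> carrier R" for l
    using var by simp
  show ?case
    unfolding eq shift[OF cp] shift[OF var.hyps(1)] var.IH[OF k]
    using component_homogeneous_mult[OF homogeneous[OF var.hyps(2)] ei pc var.prems]
      component_zero[OF var.prems] by simp
qed

lemma component_rees_ideal:
  assumes "p \<in> rees_ideal R fs" "h \<in> carrier G"
  shows "comp h p \<in> rees_ideal R fs"
proof -
  interpret UP: UP_cring R "UP R" by unfold_locales
  interpret rees: ring_hom_cring S "UP R" "rees_map R fs"
    by (rule R.rees_map_hom[OF homogeneous_gens_closed])
  note iff = R.rees_ideal_iff[OF homogeneous_gens_closed]
  have p: "p \<in> carrier S" "rees_map R fs p = \<zero>\<^bsub>UP R\<^esub>" using assms by (simp_all add: iff)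
  have c: "comp h p \<in> carrier S" using p assms by (simp add: mpoly_component_closed[OF e])
  have "rees_map R fs (comp h p) = \<zero>\<^bsub>UP R\<^esub>"
  proof (rule UP.up_eqI)
    fix n
    show "up_ring.coeff (UP R) (rees_map R fs (comp h p)) n = up_ring.coeff (UP R) \<zero>\<^bsub>UP R\<^esub> n"
      using coeff_rees_map_component[OF p(1) assms(2), of n] component_zero[OF assms(2)] by (simp add: p(2))
  qed (use c in simp_all)
  with c show ?thesis by (simp add: iff)
qed

text \<open>A projection of a linear relation is a linear form in J, hence again a linear relation.
  So it is enough that the set \<open>?M\<close> of polynomials whose projections all lie in L is an
  ideal; the work lies in closure under multipliers.\<close>

lemma component_linear_ideal:
  assumes "p \<in> linear_ideal R fs" "h \<in> carrier G"
  shows "comp h p \<in> linear_ideal R fs"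
proof -
  interpret S: cring S by (rule R.cring_mpoly_ring)
  interpret L: ideal "linear_ideal R fs" S by (rule R.ideal_linear_ideal[OF homogeneous_gens_closed])
  let ?M = "{p \<in> carrier S. \<forall>h\<in>carrier G. comp h p \<in> linear_ideal R fs}"
  have M_add: "p \<oplus>\<^bsub>S\<^esub> q \<in> ?M" if "p \<in> ?M" "q \<in> ?M" for p q
    using that by (auto simp: mpoly_component_add[OF e])
  \<comment> \<open>A homogeneous constant only shifts the degree of the projection, and
    \<open>?M\<close> allows all degrees; a general constant is the sum of its components.\<close>
  have scale: "R.indexed_const k \<otimes>\<^bsub>S\<^esub> p \<in> ?M" if k: "k \<in> carrier R" and p: "p \<in> ?M" for k p
  proof -
    have hom: "R.indexed_const a \<otimes>\<^bsub>S\<^esub> p \<in> ?M" if "a \<in> A g" "g \<in> carrier G" for a g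
      using that p homogeneous_closed[OF that]
      by (auto simp: mpoly_component_homogeneous_mult[OF e] R.mpoly_const_closed intro!: L.I_l_closed)
    \<comment> \<open>Zero is homogeneous of every degree; the neutral degree is an arbitrary
      choice. This starts the induction on H.\<close>
    have zero: "R.indexed_const \<zero> \<otimes>\<^bsub>S\<^esub> p \<in> ?M"
      by (rule hom[OF zero_homogeneous G.one_closed]) (rule G.one_closed)
    have fin: "R.indexed_const (\<Oplus>g\<in>H. component g k) \<otimes>\<^bsub>S\<^esub> p \<in> ?M"
      if "finite H" "H \<subseteq> carrier G" for H
      using that
    proof (induction H)
      case empty
      then show ?case using zero by simp
    next
      case (insert g H)
      have c: "component g k \<in> carrier R" "(\<Oplus>g\<in>H. component g k) \<in> carrier R"
        using insert k component_closed by (auto intro!: R.finsum_closed)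
      have "(\<Oplus>g\<in>insert g H. component g k) = component g k \<oplus> (\<Oplus>g\<in>H. component g k)"
        using insert c k component_closed by (intro R.finsum_insert) auto
      then have eq: "R.indexed_const (\<Oplus>g\<in>insert g H. component g k) \<otimes>\<^bsub>S\<^esub> p =
          R.indexed_const (component g k) \<otimes>\<^bsub>S\<^esub> p \<oplus>\<^bsub>S\<^esub> R.indexed_const (\<Oplus>g\<in>H. component g k) \<otimes>\<^bsub>S\<^esub> p"
        using p c ring_hom_add[OF R.mpoly_const_hom c] S.l_distr[OF R.mpoly_const_closed[OF c(1)] R.mpoly_const_closed[OF c(2)]]
        by simp
      have 1: "R.indexed_const (component g k) \<otimes>\<^bsub>S\<^esub> p \<in> ?M"
        using insert k by (intro hom[OF component_homogeneous]) auto
      have 2: "R.indexed_const (\<Oplus>g\<in>H. component g k) \<otimes>\<^bsub>S\<^esub> p \<in> ?M"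
        using insert by blast
      show ?case unfolding eq by (rule M_add[OF 1 2])
    qed
    show ?thesis
      using fin[OF finite_support_component[OF k]]
        finsum_component[OF k finite_support_component[OF k]] by auto
  qed
  \<comment> \<open>A general multiplier is built from constants and variables, and a factor y_i
    again only shifts the degree of the projection.\<close>
  have mult: "q \<otimes>\<^bsub>S\<^esub> p \<in> ?M" if q: "q \<in> carrier S" and p: "p \<in> ?M" for q p
    using q
  proof (induction rule: R.mpoly_ring_induct)
    case (const k)
    then show ?case using scale p by blast
  next
    case (add q q')
    have eq: "(q \<oplus>\<^bsub>S\<^esub> q') \<otimes>\<^bsub>S\<^esub> p = q \<otimes>\<^bsub>S\<^esub> p \<oplus>\<^bsub>S\<^esub> q' \<otimes>\<^bsub>S\<^esub> p"
      using add.hyps p by (simp add: S.l_distr)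
    show ?case unfolding eq by (rule M_add[OF add.IH])
  next
    case (var q i)
    have y: "R.indexed_var i \<in> carrier S" using var by (simp add: R.mpoly_var_closed)
    have qp: "q \<otimes>\<^bsub>S\<^esub> p \<in> carrier S" using var.IH by blast
    have "comp h (R.indexed_var i \<otimes>\<^bsub>S\<^esub> (q \<otimes>\<^bsub>S\<^esub> p)) \<in> linear_ideal R fs" if h: "h \<in> carrier G" for h
    proof -
      have "inv\<^bsub>G\<^esub> e i \<otimes>\<^bsub>G\<^esub> h \<in> carrier G" using e var.hyps h by auto
      then have "comp (inv\<^bsub>G\<^esub> e i \<otimes>\<^bsub>G\<^esub> h) (q \<otimes>\<^bsub>S\<^esub> p) \<in> linear_ideal R fs" using var.IH by blast
      then show ?thesis
        unfolding mpoly_component_var_mult[OF e qp var.hyps(2) h] using y by (rule L.I_l_closed)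
    qed
    moreover have "R.indexed_var i \<otimes>\<^bsub>S\<^esub> q \<otimes>\<^bsub>S\<^esub> p = R.indexed_var i \<otimes>\<^bsub>S\<^esub> (q \<otimes>\<^bsub>S\<^esub> p)"
      using y var.hyps p by (simp add: S.m_assoc)
    ultimately show ?case using y qp by simp
  qed
  have "ideal ?M S"
  proof (rule idealI)
    show "subgroup ?M (add_monoid S)"
    proof (rule S.add.subgroupI)
      have "comp h \<zero>\<^bsub>S\<^esub> = \<zero>\<^bsub>S\<^esub>" if "h \<in> carrier G" for h
        using mpoly_component_finsum[OF e, of "\<lambda>_. \<zero>\<^bsub>S\<^esub>" "{}" h] that by simp
      then have "\<zero>\<^bsub>S\<^esub> \<in> ?M" by simp
      then show "?M \<noteq> {}" by blast
    next
      fix p assume p: "p \<in> ?M"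
      then have pc: "p \<in> carrier S" by blast
      have "(\<ominus>\<^bsub>S\<^esub> \<one>\<^bsub>S\<^esub>) \<otimes>\<^bsub>S\<^esub> p \<in> ?M" by (rule mult[OF _ p]) simp
      moreover have "(\<ominus>\<^bsub>S\<^esub> \<one>\<^bsub>S\<^esub>) \<otimes>\<^bsub>S\<^esub> p = \<ominus>\<^bsub>S\<^esub> p" using pc by (simp add: S.l_minus)
      ultimately show "\<ominus>\<^bsub>S\<^esub> p \<in> ?M" by (rule back_subst)
    qed (use M_add in auto)
    fix p q assume p: "p \<in> ?M" and q: "q \<in> carrier S"
    show "q \<otimes>\<^bsub>S\<^esub> p \<in> ?M" using mult[OF q p] .
    moreover have "q \<otimes>\<^bsub>S\<^esub> p = p \<otimes>\<^bsub>S\<^esub> q" using p q S.m_comm by blast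
    ultimately show "p \<otimes>\<^bsub>S\<^esub> q \<in> ?M" by (rule back_subst)
  qed (rule S.ring_axioms)
  moreover have "linear_relations R fs \<subseteq> ?M"
  proof
    fix p assume p: "p \<in> linear_relations R fs"
    then have "comp h p \<in> linear_relations R fs" if "h \<in> carrier G" for h
      using that component_rees_ideal mpoly_component_linear_form[OF e]
      by (auto simp: R.linear_relations_eq[OF homogeneous_gens_closed])
    then show "p \<in> ?M"
      using p R.linear_relations_closed[OF homogeneous_gens_closed]
        R.linear_relation_in_linear_ideal[OF homogeneous_gens_closed] by blast
  qed
  ultimately have "linear_ideal R fs \<subseteq> ?M"
    unfolding linear_ideal_def by (rule S.genideal_minimal)
  then show ?thesis using assms by blast
qed

lemma component_conductor:
  assumes r: "r \<in> conductor R fs" and g: "g \<in> carrier G"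
  shows "component g r \<in> conductor R fs"
proof -
  interpret S: cring S by (rule R.cring_mpoly_ring)
  interpret L: ideal "linear_ideal R fs" S by (rule R.ideal_linear_ideal[OF homogeneous_gens_closed])
  note iff = R.conductor_iff[OF homogeneous_gens_closed]
  have rc: "r \<in> carrier R" using r iff by blast
  have gc: "R.indexed_const (component g r) \<in> carrier S"
    using rc g by (simp add: R.mpoly_const_closed component_closed)
  have "R.indexed_const (component g r) \<otimes>\<^bsub>S\<^esub> p \<in> linear_ideal R fs" if p: "p \<in> rees_ideal R fs" for p
  proof -
    have pc: "p \<in> carrier S" using p R.rees_ideal_iff[OF homogeneous_gens_closed] by blast
    obtain H where H: "finite H" "H \<subseteq> carrier G" "p = (\<Oplus>\<^bsub>S\<^esub>h\<in>H. comp h p)"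
      using sum_mpoly_component[OF e pc] by metis
    have cc: "(\<lambda>h. comp h p) \<in> H \<rightarrow> carrier S"
      using H(2) pc mpoly_component_closed[OF e] by blast
    have "R.indexed_const (component g r) \<otimes>\<^bsub>S\<^esub> (\<Oplus>\<^bsub>S\<^esub>h\<in>H. comp h p) =
        (\<Oplus>\<^bsub>S\<^esub>h\<in>H. R.indexed_const (component g r) \<otimes>\<^bsub>S\<^esub> comp h p)"
      using H(1) gc cc by (rule S.finsum_rdistr)
    moreover have "R.indexed_const (component g r) \<otimes>\<^bsub>S\<^esub> comp h p \<in> linear_ideal R fs" if "h \<in> H" for h
    proof -
      have h: "h \<in> carrier G" using that H(2) by blast
      have "R.indexed_const r \<otimes>\<^bsub>S\<^esub> comp h p \<in> linear_ideal R fs"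
        using r iff component_rees_ideal[OF p h] by blast
      then have "comp (g \<otimes>\<^bsub>G\<^esub> h) (R.indexed_const r \<otimes>\<^bsub>S\<^esub> comp h p) \<in> linear_ideal R fs"
        using g h by (intro component_linear_ideal) simp_all
      then show ?thesis by (simp only: mpoly_component_mult_homogeneous[OF e rc pc g h])
    qed
    ultimately show ?thesis using H(3) L.finsum_mem[of "\<lambda>h. R.indexed_const (component g r) \<otimes>\<^bsub>S\<^esub> comp h p" H] by auto
  qed
  then show ?thesis using rc g component_closed iff by blast
qed

end

text \<open>The components of the generators stay in the ideal because it is graded, and each
  generator is the sum of its components; so both sets generate the same ideal.\<close>

lemma homogeneous_generators:
  assumes I: "graded_ideal R G A (Idl (set fs))" and fs: "set fs \<subseteq> carrier R"
  obtains gs e where "e \<in> {..<length gs} \<rightarrow> carrier G"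
    and "\<And>i. i < length gs \<Longrightarrow> gs ! i \<in> A (e i)" and "Idl (set gs) = Idl (set fs)"
proof -
  let ?I = "Idl (set fs)"
  have "\<forall>f\<in>set fs. \<exists>c. homogeneous_decomposition R G (\<lambda>g. ?I \<inter> A g) f c"
    using I R.genideal_self[OF fs] unfolding graded_ideal_def by blast
  then obtain c where c: "\<And>f. f \<in> set fs \<Longrightarrow> homogeneous_decomposition R G (\<lambda>g. ?I \<inter> A g) f (c f)"
    by metis
  let ?S = "\<lambda>f. {g \<in> carrier G. c f g \<noteq> \<zero>}"
  have mem: "c f g \<in> ?I" "c f g \<in> A g" if "f \<in> set fs" "g \<in> carrier G" for f g
    using c[OF that(1)] that(2) by (auto simp: homogeneous_decomposition_def)
  have fin: "finite (?S f)" and sum: "f = (\<Oplus>g\<in>?S f. c f g)" if "f \<in> set fs" for f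
    using c[OF that] unfolding homogeneous_decomposition_def by blast+
  \<comment> \<open>Each component is recorded with its degree, so that once the finite set is
    listed, e can be read off the first entries.\<close>
  let ?P = "\<Union>f\<in>set fs. (\<lambda>g. (g, c f g)) ` ?S f"
  have "finite ?P" by (intro finite_UN_I finite_imageI fin finite_set)
  from finite_list[OF this] obtain ps where ps: "set ps = ?P" ..
  let ?gs = "map snd ps"
  have ps_nth: "fst (ps ! i) \<in> carrier G \<and> snd (ps ! i) \<in> A (fst (ps ! i)) \<and> snd (ps ! i) \<in> ?I"
    if "i < length ps" for i
  proof -
    have "ps ! i \<in> ?P" unfolding ps[symmetric] using that by (rule nth_mem)
    then obtain f g where "f \<in> set fs" "g \<in> ?S f" "ps ! i = (g, c f g)" by blast
    then show ?thesis using mem by simp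
  qed
  have gsI: "set ?gs \<subseteq> ?I"
  proof
    fix f assume "f \<in> set ?gs"
    then obtain i where "i < length ps" "f = snd (ps ! i)" by (auto simp: in_set_conv_nth simp del: set_map)
    then show "f \<in> ?I" using ps_nth by simp
  qed
  interpret I: ideal ?I R by (rule R.genideal_ideal[OF fs])
  have gsR: "set ?gs \<subseteq> carrier R" using gsI I.a_subset by blast
  interpret J: ideal "Idl (set ?gs)" R by (rule R.genideal_ideal[OF gsR])
  have "f \<in> Idl (set ?gs)" if f: "f \<in> set fs" for f
  proof -
    have "c f g \<in> set ?gs" if "g \<in> ?S f" for g
    proof -
      have "(g, c f g) \<in> set ps" unfolding ps using f that by blast
      then show ?thesis by force
    qed
    then have "(\<Oplus>g\<in>?S f. c f g) \<in> Idl (set ?gs)"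
      using R.genideal_self[OF gsR] by (intro J.finsum_mem) blast
    then show ?thesis using sum[OF f] by simp
  qed
  then have "?I \<subseteq> Idl (set ?gs)" using J.is_ideal by (intro R.genideal_minimal) auto
  moreover have "Idl (set ?gs) \<subseteq> ?I" using gsI I.is_ideal by (intro R.genideal_minimal)
  ultimately have "Idl (set ?gs) = ?I" by blast
  then show ?thesis
    using ps_nth by (intro that[of "\<lambda>i. fst (ps ! i)" ?gs]) auto
qed

theorem graded_ideal_conductor:
  assumes fs: "set fs \<subseteq> carrier R" and "graded_ideal R G A (Idl (set fs))"
  shows "graded_ideal R G A (conductor R fs)"
proof -
  obtain gs e where gs: "e \<in> {..<length gs} \<rightarrow> carrier G"
      "\<And>i. i < length gs \<Longrightarrow> gs ! i \<in> A (e i)" "Idl (set gs) = Idl (set fs)"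
    using homogeneous_generators[OF assms(2,1)] by metis
  have gsR: "set gs \<subseteq> carrier R" using gs(1,2) by (rule homogeneous_gens_closed)
  have eq: "conductor R fs = conductor R gs"
    using R.conductor_subset[OF fs gsR] R.conductor_subset[OF gsR fs] gs(3) by auto
  \<comment> \<open>The decomposition of r in R itself is the witness; only membership of its
    entries in the conductor has to be added.\<close>
  have "homogeneous_decomposition R G (\<lambda>g. conductor R gs \<inter> A g) r (\<lambda>g. component g r)"
    if r: "r \<in> conductor R gs" for r
  proof -
    have rc: "r \<in> carrier R" using r R.conductor_iff[OF gsR] by blast
    have "component g r \<in> conductor R gs" if "g \<in> carrier G" for g
      using gs(1,2) r that by (rule component_conductor)
    then show ?thesis
      using homogeneous_decomposition_component[OF rc]
      by (auto simp: homogeneous_decomposition_def PiE_iff)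
  qed
  then show ?thesis
    unfolding graded_ideal_def eq using R.ideal_conductor[OF gsR] by blast
qed

end

theorem proposition1p10:
  fixes R (structure)
    and n :: nat
    and A :: "(nat \<Rightarrow> int) \<Rightarrow> 'a set"
    and I :: "'a set"
    and fs :: "'a list"
  assumes "noetherian_ring R"
    and "graded_ring R (int_power_group n) A"
    and "graded_ideal R (int_power_group n) A I"
    and "set fs \<subseteq> carrier R"
    and "I = Idl (set fs)"
  shows "graded_ideal R (int_power_group n) A (conductor R fs)"
  \<comment> \<open>\<open>graded_ring\<close> contains the assertion that the group of degrees is
    abelian, so the result for arbitrary such groups specialises directly.\<close>
  using graded_ring.graded_ideal_conductor[OF assms(2,4)] assms(3,5) by simp

end
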